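(* Define $T_{n,k}$ (with $a_1,a_2,b_1,b_2,\lambda$ real parameters or indeterminates) by $T_{0,0}=1$, $T_{n,k}=0$ unless $0\le k\le n$, and for $n\ge1$ $$T_{n,k}=(b_1k+b_2)T_{n-1,k-1}+[(2\lambda b_1+a_1)k+a_2+\lambda(b_1+b_2)]T_{n-1,k}+\lambda(a_1+\lambda b_1)(k+1)T_{n-1,k+1},$$ and let $T_n(q)=\sum_{k\ge0}T_{n,k}q^k$. Let $s_n=a_2+a_1n+[b_1(2n+1)+b_2](q+\lambda)$ and $r_{n+1}=[b_1(n+1)+b_2](q+\lambda)[b_1(q+\lambda)+a_1](n+1)$ for $n\geq0$. Then: (i) as formal power series in $t$, $$\sum_{n\geq0}T_n(q)t^n=\cfrac{1}{1-s_0t-\cfrac{r_1t^2}{1-s_1t-\cfrac{r_2t^2}{1-s_2t-\cdots}}};$$ (ii) regarding $a_1,a_2,b_1,b_2,\lambda,q$ as indeterminates, the sequence $(T_n(q))_{n\geq0}$ is $\mathbf{x}$-Stieltjes moment and $3$-$\mathbf{x}$-log-convex with $\mathbf{x}=(a_1,a_2,b_1,b_2,\lambda,q)$; (iii) if $\lambda,a_1,a_2,b_1,b_2$ are nonnegative reals, then for any Stieltjes moment sequences $(x_n)_{n\ge0}$ and $(y_n)_{n\ge0}$ the sequence $z_n=\sum_{k\geq0}T_{n,k}x_ky_{n-k}$ is a Stieltjes moment sequence; (iv) for $n\ge1$, $$\det_{0\leq i,j\leq n-1}(T_{i+j}(q))=r_1^{n-1}r_2^{n-2}\cdots r_{n-2}^2r_{n-1},\qquad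 \det_{0\leq i,j\leq n-1}(T_{i+j+1}(q))=r_1^{n-1}r_2^{n-2}\cdots r_{n-2}^2r_{n-1}Q_n,$$ where $Q_0=1$, $Q_1=s_0$ and $Q_{n+1}=s_nQ_n-r_nQ_{n-1}$ for $n\ge1$.
   Context: A real sequence $(a_n)_{n\ge0}$ is a Stieltjes moment sequence if $a_n=\int_0^{\infty}x^n\,d\mu(x)$ for some nonnegative measure $\mu$ on $[0,\infty)$; equivalently its Hankel matrix $[a_{i+j}]_{i,j\ge0}$ is totally positive (all minors nonnegative). For indeterminates $\mathbf{x}$, a matrix of polynomials is $\mathbf{x}$-totally positive if all its minors are polynomials in $\mathbf{x}$ with nonnegative coefficients; a polynomial sequence $(f_n(\mathbf{x}))_{n\ge0}$ is $\mathbf{x}$-Stieltjes moment if its Hankel matrix $[f_{i+j}(\mathbf{x})]_{i,j\ge0}$ is $\mathbf{x}$-totally positive. Define the operator $\mathcal{L}$ sending $(f_n)_{n\ge0}$ to $(g_i)_{i\ge1}$ with $g_i=f_{i-1}f_{i+1}-f_i^2$; the sequence is $k$-$\mathbf{x}$-log-convex if for every $m\le k$ all polynomials in $\mathcal{L}^m\{f_n\}$ (with $\mathcal{L}^m=\mathcal{L}(\mathcal{L}^{m-1})$) have nonnegative coefficients in $\mathbf{x}$. *)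

theory Defs
  imports
    "HOL-Analysis.Bochner_Integration"
    "HOL-Computational_Algebra.Formal_Power_Series"
    "HOL-Library.Poly_Mapping"
    "Jordan_Normal_Form.Determinant"
begin

section \<open>The triangle and its row polynomials\<close>

text \<open>
  Everything is defined over an arbitrary commutative ring, so that the parameters and \<open>q\<close>
  may be instantiated by real numbers as well as by indeterminates of a polynomial ring.
\<close>

fun T_coeff :: "'a::comm_ring_1 \<Rightarrow> 'a \<Rightarrow> 'a \<Rightarrow> 'a \<Rightarrow> 'a \<Rightarrow> nat \<Rightarrow> nat \<Rightarrow> 'a" where
  "T_coeff a1 a2 b1 b2 lam 0 k = (if k = 0 then 1 else 0)"
| "T_coeff a1 a2 b1 b2 lam (Suc n) k =
     (if k = 0 then 0 else (b1 * of_nat k + b2) * T_coeff a1 a2 b1 b2 lam n (k - 1))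
     + ((2 * lam * b1 + a1) * of_nat k + a2 + lam * (b1 + b2)) * T_coeff a1 a2 b1 b2 lam n k
     + lam * (a1 + lam * b1) * of_nat (k + 1) * T_coeff a1 a2 b1 b2 lam n (k + 1)"

text \<open>The convention that the entries vanish above the diagonal is a consequence of the recursion.\<close>

lemma T_coeff_eq_0: "n < k \<Longrightarrow> T_coeff a1 a2 b1 b2 lam n k = 0"
  by (induction n arbitrary: k) auto

definition T_poly :: "'a::comm_ring_1 \<Rightarrow> 'a \<Rightarrow> 'a \<Rightarrow> 'a \<Rightarrow> 'a \<Rightarrow> 'a \<Rightarrow> nat \<Rightarrow> 'a" where
  "T_poly a1 a2 b1 b2 lam q n = (\<Sum>k\<le>n. T_coeff a1 a2 b1 b2 lam n k * q ^ k)"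

definition s_seq :: "'a::comm_ring_1 \<Rightarrow> 'a \<Rightarrow> 'a \<Rightarrow> 'a \<Rightarrow> 'a \<Rightarrow> 'a \<Rightarrow> nat \<Rightarrow> 'a" where
  "s_seq a1 a2 b1 b2 lam q n =
     a2 + a1 * of_nat n + (b1 * of_nat (2 * n + 1) + b2) * (q + lam)"

text \<open>Only the values at \<open>n \<ge> 1\<close> matter; \<open>a2\<close> does not occur.\<close>

definition r_seq :: "'a::comm_ring_1 \<Rightarrow> 'a \<Rightarrow> 'a \<Rightarrow> 'a \<Rightarrow> 'a \<Rightarrow> nat \<Rightarrow> 'a" where
  "r_seq a1 b1 b2 lam q n =
     (b1 * of_nat n + b2) * (q + lam) * (b1 * (q + lam) + a1) * of_nat n"

fun Q_seq :: "(nat \<Rightarrow> 'a::comm_ring_1) \<Rightarrow> (nat \<Rightarrow> 'a) \<Rightarrow> nat \<Rightarrow> 'a" where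
  "Q_seq s r 0 = 1"
| "Q_seq s r (Suc 0) = s 0"
| "Q_seq s r (Suc (Suc n)) = s (Suc n) * Q_seq s r (Suc n) - r (Suc n) * Q_seq s r n"


section \<open>Jacobi continued fractions as formal power series\<close>

text \<open>
  \<open>J_tail s r m n\<close> keeps the first \<open>m\<close> levels of the continued fraction that starts with
  \<open>s n\<close> and \<open>r (n + 1)\<close>. Every denominator has constant coefficient 1 and is hence
  invertible over any commutative ring; \<open>fps_right_inverse _ 1\<close> is its inverse.
\<close>

fun J_tail :: "(nat \<Rightarrow> 'a::comm_ring_1) \<Rightarrow> (nat \<Rightarrow> 'a) \<Rightarrow> nat \<Rightarrow> nat \<Rightarrow> 'a fps" where
  "J_tail s r 0 n = 0"
| "J_tail s r (Suc m) n =
     fps_right_inverse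
       (1 - fps_const (s n) * fps_X - fps_const (r (Suc n)) * fps_X ^ 2 * J_tail s r m (Suc n)) 1"

lemma J_tail_Suc_inverse:
  "(1 - fps_const (s n) * fps_X - fps_const (r (Suc n)) * fps_X ^ 2 * J_tail s r m (Suc n))
     * J_tail s r (Suc m) n = 1"
  unfolding J_tail.simps(2)
  by (rule fps_right_inverse) (simp add: power2_eq_square fps_mult_nth_0)

text \<open>The limit of the convergents is taken in the usual topology on formal power series.\<close>

definition has_J_fraction ::
    "'a::comm_ring_1 fps \<Rightarrow> (nat \<Rightarrow> 'a) \<Rightarrow> (nat \<Rightarrow> 'a) \<Rightarrow> bool" where
  "has_J_fraction F s r \<longleftrightarrow> (\<lambda>m. J_tail s r m 0) \<longlonglongrightarrow> F"


section \<open>Total positivity and log-convexity of polynomial sequences\<close>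

text \<open>
  Polynomials with real coefficients in the indeterminates \<open>'x\<close>: finitely supported functions
  from exponent vectors to coefficients, with convolution as multiplication.
\<close>

type_synonym 'x mpoly = "('x \<Rightarrow>\<^sub>0 nat) \<Rightarrow>\<^sub>0 real"

definition mvar :: "'x \<Rightarrow> 'x mpoly" where
  "mvar x = Poly_Mapping.single (Poly_Mapping.single x 1) 1"

definition nonneg_coeffs :: "'x mpoly \<Rightarrow> bool" where
  "nonneg_coeffs p \<longleftrightarrow> (\<forall>m. 0 \<le> Poly_Mapping.lookup p m)"

text \<open>A minor selects increasing rows \<open>\<rho> 0 < \<dots> < \<rho> (n - 1)\<close> and columns \<open>\<gamma> 0 < \<dots> < \<gamma> (n - 1)\<close>.\<close>

definition x_totally_positive :: "(nat \<Rightarrow> nat \<Rightarrow> 'x mpoly) \<Rightarrow> bool" where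
  "x_totally_positive M \<longleftrightarrow>
     (\<forall>n \<rho> \<gamma>. strict_mono_on {..<n} \<rho> \<longrightarrow> strict_mono_on {..<n} \<gamma> \<longrightarrow>
        nonneg_coeffs (Determinant.det (Matrix.mat n n (\<lambda>(i, j). M (\<rho> i) (\<gamma> j)))))"

definition x_Stieltjes_moment :: "(nat \<Rightarrow> 'x mpoly) \<Rightarrow> bool" where
  "x_Stieltjes_moment f \<longleftrightarrow> x_totally_positive (\<lambda>i j. f (i + j))"

text \<open>
  The original indices are kept: the sequence \<open>LC f\<close> starts at index 1 and
  \<open>(LC ^^ m) f\<close> starts at index \<open>m\<close>. Values at smaller indices are meaningless
  (truncated subtraction) and do not influence those at indices \<open>\<ge> m\<close>.
\<close>

definition LC :: "(nat \<Rightarrow> 'a::comm_ring_1) \<Rightarrow> nat \<Rightarrow> 'a" where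
  "LC f i = f (i - 1) * f (i + 1) - f i ^ 2"

definition x_log_convex :: "nat \<Rightarrow> (nat \<Rightarrow> 'x mpoly) \<Rightarrow> bool" where
  "x_log_convex k f \<longleftrightarrow> (\<forall>m\<le>k. \<forall>i\<ge>m. nonneg_coeffs ((LC ^^ m) f i))"

datatype indet = Ind_a1 | Ind_a2 | Ind_b1 | Ind_b2 | Ind_lam | Ind_q


section \<open>Stieltjes moment sequences\<close>

text \<open>\<open>M\<close> is a Borel measure on the half-line \<open>[0, \<infinity>)\<close> all of whose moments exist.\<close>

definition Stieltjes_moment :: "(nat \<Rightarrow> real) \<Rightarrow> bool" where
  "Stieltjes_moment a \<longleftrightarrow>
     (\<exists>M :: real measure. sets M = sets (restrict_space borel {0..}) \<and>
        (\<forall>n. has_bochner_integral M (\<lambda>x. x ^ n) (a n)))"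

end

theory Submission
  imports Defs "HOL-Analysis.Gamma_Function"
begin

text \<open>
  The recurrence for \<open>T_coeff\<close> is the Taylor expansion of the case \<open>lam = 0\<close>: replacing \<open>lam\<close> by
  \<open>lam + q\<close> re-expands the row polynomials, so \<open>T_poly \<dots> lam q n = T_coeff \<dots> (lam + q) n 0\<close> counts
  weighted Motzkin paths with level weights \<open>s_seq\<close> and \<open>r_seq\<close>. Hence the continued fraction, and
  the factorisation of the Hankel matrix as \<open>S R S\<^sup>T\<close> with \<open>S\<close> the unit lower triangular Stieltjes matrix
  and \<open>R\<close> diagonal, which gives the determinants.

  Up to the summand \<open>a2\<close>, \<open>s n = e n + f n\<close> and \<open>r n = f n * e (n - 1)\<close> with \<open>e\<close>, \<open>f\<close> having
  nonnegative coefficients, so \<open>S\<close> is a product of bidiagonal matrices, each of which acts by adding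
  multiples of a row to the next one and thus preserves total positivity; \<open>a2\<close> contributes a
  binomial transform, which is of the same kind. Log-convexity follows by writing the iterates of \<open>LC\<close>
  in terms of Hankel minors.

  For the convolution the representing measure is explicit: with independent \<open>X\<close>, \<open>Y\<close>, \<open>G\<close>, where \<open>X\<close>
  and \<open>Y\<close> represent the given sequences and \<open>G\<close> is a scaled Gamma variable, it is the law of
  \<open>a2 Y + a1 Y P\<close> with \<open>P\<close> Poisson distributed of mean \<open>(X + lam Y) G / (a1 Y)\<close>.
\<close>

section \<open>Dependence on \<open>lam\<close> and \<open>q\<close> through their sum\<close>

section \<open>Translation of the parameter\<close>

text \<open>\<open>B j k\<close> is the coefficient of X^k in (X + q)^j. The rules express
  multiplication by X + q (with \<open>k = 0\<close> apart), differentiation, and the Euler operator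
  (X + q) d/dX, for which (X + q)^j is an eigenvector with eigenvalue j.\<close>

lemma binomial_power_identities:
  fixes q :: "'a::comm_ring_1"
  defines "B \<equiv> \<lambda>j k. of_nat (j choose k) * q ^ (j - k)"
  shows binomial_power_Suc: "B (Suc j) (Suc k) = q * B j (Suc k) + B j k"
    and binomial_power_Suc_0: "B (Suc j) 0 = q * B j 0"
    and binomial_power_pred: "of_nat (Suc j) * B j k = of_nat (Suc k) * B (Suc j) (Suc k)"
    and binomial_power_absorb: "of_nat j * B j k = of_nat k * B j k + q * of_nat (Suc k) * B j (Suc k)"
proof -
  show "B (Suc j) (Suc k) = q * B j (Suc k) + B j k"
  proof (cases "Suc k \<le> j")
    case True
    then have "j - k = Suc (j - Suc k)" by simp
    then show ?thesis by (simp add: B_def algebra_simps)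
  next
    case False
    then show ?thesis by (cases "j = k") (auto simp: B_def binomial_eq_0)
  qed
  show "B (Suc j) 0 = q * B j 0" by (simp add: B_def)
  have "(of_nat (Suc j) * of_nat (j choose k) :: 'a) = of_nat (Suc j choose Suc k) * of_nat (Suc k)"
    by (metis of_nat_mult Suc_times_binomial_eq)
  then show "of_nat (Suc j) * B j k = of_nat (Suc k) * B (Suc j) (Suc k)"
    unfolding B_def diff_Suc_Suc mult.assoc[symmetric] by (simp only: mult_ac)
  show "of_nat j * B j k = of_nat k * B j k + q * of_nat (Suc k) * B j (Suc k)"
  proof (cases "Suc k \<le> j")
    case True
    then have e: "q ^ (j - k) = q * q ^ (j - Suc k)"
      by (metis Suc_diff_Suc Suc_le_lessD power_Suc)
    have "Suc k * (j choose Suc k) = (j - k) * (j choose k)"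
      by (simp only: binomial_absorption binomial_absorb_comp)
    then have "j * (j choose k) = k * (j choose k) + Suc k * (j choose Suc k)"
      using True by (simp add: diff_mult_distrib)
    then have "(of_nat j :: 'a) * of_nat (j choose k) = of_nat k * of_nat (j choose k) + of_nat (Suc k) * of_nat (j choose Suc k)"
      by (metis of_nat_add of_nat_mult)
    then have "of_nat j * of_nat (j choose k) * q ^ (j - k) = (of_nat k * of_nat (j choose k) + of_nat (Suc k) * of_nat (j choose Suc k)) * q ^ (j - k)"
      by simp
    then show ?thesis unfolding B_def by (simp only: e) (simp add: algebra_simps)
  next
    case False
    then show ?thesis by (cases "j = k") (auto simp: B_def binomial_eq_0)
  qed
qed

text \<open>With z = x + lam, the recurrence for the row polynomials reads T_(n+1)(x) = (a2 + (b1 +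
  b2) z) T_n(x) + z (b1 z + a1) T_n'(x). Only z enters, so raising \<open>lam\<close> by
  \<open>q\<close> is the substitution of x + q for x, which is the binomial sum on
  coefficients.\<close>

lemma T_coeff_add_lam:
  fixes q :: "'a::comm_ring_1"
  shows "T_coeff a1 a2 b1 b2 (lam + q) n k
    = (\<Sum>j\<le>n. of_nat (j choose k) * q ^ (j - k) * T_coeff a1 a2 b1 b2 lam n j)"
proof (induction n arbitrary: k)
  case 0
  then show ?case by (cases k) auto
next
  case (Suc n)
  define B where "B = (\<lambda>j k. of_nat (j choose k) * q ^ (j - k))"
  define c where "c = T_coeff a1 a2 b1 b2 lam n"
  define w where "w = lam * (a1 + lam * b1)"
  define d where "d = (\<lambda>j. (2 * lam * b1 + a1) * of_nat j + a2 + lam * (b1 + b2))"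
  have c0: "c j = 0" if "j > n" for j
    using that by (simp add: c_def T_coeff_eq_0)
  have B1: "B (Suc j) (Suc k) = q * B j (Suc k) + B j k" for j k
    unfolding B_def by (rule binomial_power_Suc)
  have B2: "B (Suc j) 0 = q * B j 0" for j
    unfolding B_def by (rule binomial_power_Suc_0)
  have B3: "of_nat (Suc j) * B j k = of_nat (Suc k) * B (Suc j) (Suc k)" for j k
    unfolding B_def by (rule binomial_power_pred)
  have B4: "of_nat j * B j k = of_nat k * B j k + q * of_nat (Suc k) * B j (Suc k)" for j k
    unfolding B_def by (rule binomial_power_absorb)
  have IH: "T_coeff a1 a2 b1 b2 (lam + q) n k = (\<Sum>j\<le>n. B j k * c j)" for k
    using Suc.IH[of k] by (simp add: B_def c_def)
  have s1: "(\<Sum>j\<le>Suc n. B j k * (if j = 0 then 0 else (b1 * of_nat j + b2) * c (j - 1)))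
      = (\<Sum>j\<le>n. B (Suc j) k * (b1 * of_nat (Suc j) + b2) * c j)"
    by (subst sum.atMost_Suc_shift) (simp add: mult.assoc)
  have s2: "(\<Sum>j\<le>Suc n. B j k * (d j * c j)) = (\<Sum>j\<le>n. B j k * d j * c j)"
    by (simp add: c0 mult.assoc)
  \<comment> \<open>The shift adds a zero term at \<open>j = 0\<close>, and \<open>c\<close>
    vanishes beyond \<open>n\<close>; so all three terms of the recurrence become sums over
    \<open>j \<le> n\<close> with the common factor \<open>c j\<close>.\<close>
  have "(\<Sum>j\<le>Suc n. B j k * (w * of_nat (j + 1) * c (j + 1)))
      = (\<Sum>j\<le>Suc (Suc n). if j = 0 then 0 else B (j - 1) k * (w * of_nat j * c j))"
    by (subst (2) sum.atMost_Suc_shift) simp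
  also have "\<dots> = (\<Sum>j\<le>n. if j = 0 then 0 else B (j - 1) k * (w * of_nat j * c j))"
    by (simp add: c0)
  also have "\<dots> = (\<Sum>j\<le>n. of_nat (Suc k) * B j (Suc k) * w * c j)"
  proof (intro sum.cong refl)
    fix j
    have "(if j = 0 then 0 else B (j - 1) k * of_nat j) = of_nat (Suc k) * B j (Suc k)"
      using B3[of "j - 1" k] by (cases j) (simp_all add: B_def mult.commute)
    moreover have "(if j = 0 then 0 else B (j - 1) k * (w * of_nat j * c j))
        = (if j = 0 then 0 else B (j - 1) k * of_nat j) * w * c j"
      by (simp add: mult_ac)
    ultimately show "(if j = 0 then 0 else B (j - 1) k * (w * of_nat j * c j))
        = of_nat (Suc k) * B j (Suc k) * w * c j" by simp
  qed
  finally have s3: "(\<Sum>j\<le>Suc n. B j k * (w * of_nat (j + 1) * c (j + 1)))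
      = (\<Sum>j\<le>n. of_nat (Suc k) * B j (Suc k) * w * c j)" .
  have rec: "T_coeff a1 a2 b1 b2 lam (Suc n) j
      = (if j = 0 then 0 else (b1 * of_nat j + b2) * c (j - 1)) + d j * c j + w * of_nat (j + 1) * c (j + 1)" for j
    by (simp add: c_def d_def w_def)
  have "(\<Sum>j\<le>Suc n. B j k * T_coeff a1 a2 b1 b2 lam (Suc n) j)
      = (\<Sum>j\<le>n. (B (Suc j) k * (b1 * of_nat (Suc j) + b2) + B j k * d j + of_nat (Suc k) * B j (Suc k) * w) * c j)"
    unfolding rec distrib_left sum.distrib s1 s2 s3 by (simp only: distrib_right sum.distrib)
  also have "\<dots> = (\<Sum>j\<le>n. ((if k = 0 then 0 else (b1 * of_nat k + b2) * B j (k - 1))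
        + ((2 * (lam + q) * b1 + a1) * of_nat k + a2 + (lam + q) * (b1 + b2)) * B j k
        + (lam + q) * (a1 + (lam + q) * b1) * of_nat (k + 1) * B j (k + 1)) * c j)"
  \<comment> \<open>The coefficients of \<open>c j\<close> agree: the Euler rule trades factors
    \<open>of_nat j\<close> for factors depending on \<open>k\<close>, after which Pascal's rule
    suffices.\<close>
  proof (intro sum.cong refl arg_cong2[where f="(*)"])
    fix j
    have 1: "of_nat (Suc j) * B (Suc j) k = of_nat k * B (Suc j) k + q * of_nat (Suc k) * B (Suc j) (Suc k)"
      by (rule B4)
    have 2: "B (Suc j) (Suc k) = q * B j (Suc k) + B j k" by (rule B1)
    have 3: "of_nat j * B j k = of_nat k * B j k + q * of_nat (Suc k) * B j (Suc k)" by (rule B4)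
    have 4: "B (Suc j) k = q * B j k + (if k = 0 then 0 else B j (k - 1))"
      by (cases k) (simp_all add: B1 B2)
    have 5: "B (Suc j) k * (b1 * of_nat (Suc j) + b2)
       = b1 * (of_nat k * B (Suc j) k + q * of_nat (Suc k) * B (Suc j) (Suc k)) + b2 * B (Suc j) k"
      unfolding 1[symmetric] by (simp add: algebra_simps)
    have 6: "B j k * d j = (2 * lam * b1 + a1) * (of_nat k * B j k + q * of_nat (Suc k) * B j (Suc k))
       + (a2 + lam * (b1 + b2)) * B j k"
      unfolding 3[symmetric] d_def by (simp add: algebra_simps)
    show "B (Suc j) k * (b1 * of_nat (Suc j) + b2) + B j k * d j + of_nat (Suc k) * B j (Suc k) * w
      = (if k = 0 then 0 else (b1 * of_nat k + b2) * B j (k - 1))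
        + ((2 * (lam + q) * b1 + a1) * of_nat k + a2 + (lam + q) * (b1 + b2)) * B j k
        + (lam + q) * (a1 + (lam + q) * b1) * of_nat (k + 1) * B j (k + 1)"
      unfolding 5 6 unfolding 2 4 w_def by (cases "k = 0") (simp_all add: algebra_simps)
  qed
  also have "\<dots> = (if k = 0 then 0 else (b1 * of_nat k + b2) * (\<Sum>j\<le>n. B j (k - 1) * c j))
        + ((2 * (lam + q) * b1 + a1) * of_nat k + a2 + (lam + q) * (b1 + b2)) * (\<Sum>j\<le>n. B j k * c j)
        + (lam + q) * (a1 + (lam + q) * b1) * of_nat (k + 1) * (\<Sum>j\<le>n. B j (k + 1) * c j)"
    by (cases "k = 0") (simp_all add: distrib_right sum.distrib sum_distrib_left mult.assoc)
  also have "\<dots> = T_coeff a1 a2 b1 b2 (lam + q) (Suc n) k"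
    by (simp only: T_coeff.simps IH)
  finally show ?case by (simp add: B_def)
qed

lemma T_poly_eq_T_coeff_0:
  "T_poly a1 a2 b1 b2 lam q n = T_coeff a1 a2 b1 b2 (lam + q) n 0"
  by (simp add: T_coeff_add_lam T_poly_def mult.commute)

section \<open>Weighted Motzkin paths\<close>

section \<open>Stieltjes matrices\<close>

text \<open>The weighted count of Motzkin paths of length \<open>n\<close> from height 0 to height
  \<open>k\<close>: rises weigh 1, level steps at height \<open>k\<close> weigh \<open>s k\<close>,
  falls from \<open>Suc k\<close> to \<open>k\<close> weigh \<open>r (Suc k)\<close>.\<close>

fun stieltjes_mat :: "(nat \<Rightarrow> 'a::comm_ring_1) \<Rightarrow> (nat \<Rightarrow> 'a) \<Rightarrow> nat \<Rightarrow> nat \<Rightarrow> 'a" where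
  "stieltjes_mat s r 0 k = (if k = 0 then 1 else 0)"
| "stieltjes_mat s r (Suc n) k =
     (if k = 0 then 0 else stieltjes_mat s r n (k - 1)) + s k * stieltjes_mat s r n k
     + r (Suc k) * stieltjes_mat s r n (Suc k)"

lemma stieltjes_mat_eq_0: "n < k \<Longrightarrow> stieltjes_mat s r n k = 0"
  by (induction n arbitrary: k) auto

lemma stieltjes_mat_diag: "stieltjes_mat s r n n = 1"
  by (induction n) (auto simp: stieltjes_mat_eq_0)

text \<open>Pulling the product of the rise weights out of column \<open>k\<close> normalises rises
  to 1 and multiplies each fall weight by the weight of the opposite rise, which produces
  \<open>r_seq\<close>.\<close>

lemma T_coeff_eq_stieltjes_mat:
  "T_coeff a1 a2 b1 b2 (lam + q) n k
    = (\<Prod>i=1..k. b1 * of_nat i + b2)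
      * stieltjes_mat (s_seq a1 a2 b1 b2 lam q) (r_seq a1 b1 b2 lam q) n k"
proof (induction n arbitrary: k)
  case 0
  then show ?case by auto
next
  case (Suc n)
  let ?S = "stieltjes_mat (s_seq a1 a2 b1 b2 lam q) (r_seq a1 b1 b2 lam q)"
  let ?P = "\<lambda>k. \<Prod>i=1..k. b1 * of_nat i + b2"
  have P: "?P (Suc k) = ?P k * (b1 * of_nat (Suc k) + b2)" for k
    by simp
  show ?case
  proof (cases k)
    case 0
    show ?thesis unfolding T_coeff.simps Suc.IH stieltjes_mat.simps 0 
      by (simp add: s_seq_def r_seq_def algebra_simps)
  next
    case (Suc m)
    show ?thesis unfolding T_coeff.simps Suc.IH stieltjes_mat.simps Suc add_Suc_right add_0_right One_nat_def P diff_Suc_1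
      by (simp add: s_seq_def r_seq_def  Suc.IH algebra_simps)
  qed
qed

lemma T_poly_eq_stieltjes_mat:
  "T_poly a1 a2 b1 b2 lam q n
    = stieltjes_mat (s_seq a1 a2 b1 b2 lam q) (r_seq a1 b1 b2 lam q) n 0"
  by (simp add: T_poly_eq_T_coeff_0 T_coeff_eq_stieltjes_mat)

text \<open>Row \<open>Suc n\<close> is row \<open>n\<close> times a tridiagonal matrix J; here J is
  moved onto the vector \<open>h\<close>.\<close>

lemma sum_stieltjes_mat_Suc:
  "(\<Sum>k\<le>Suc n. stieltjes_mat s r (Suc n) k * h k)
    = (\<Sum>k\<le>n. stieltjes_mat s r n k
        * ((if k = 0 then 0 else r k * h (k - 1)) + s k * h k + h (Suc k)))"
proof -
  let ?S = "stieltjes_mat s r n"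
  have z: "?S k = 0" if "k > n" for k using that by (rule stieltjes_mat_eq_0)
  have 1: "(\<Sum>k\<le>Suc n. (if k = 0 then 0 else ?S (k - 1)) * h k) = (\<Sum>k\<le>n. ?S k * h (Suc k))"
    by (subst sum.atMost_Suc_shift) simp
  have 2: "(\<Sum>k\<le>Suc n. s k * ?S k * h k) = (\<Sum>k\<le>n. ?S k * (s k * h k))"
    by (simp add: z mult_ac)
  have "(\<Sum>k\<le>Suc n. r (Suc k) * ?S (Suc k) * h k)
      = (\<Sum>k\<le>Suc (Suc n). ?S k * (if k = 0 then 0 else r k * h (k - 1)))"
    by (subst (2) sum.atMost_Suc_shift) (simp add: mult_ac)
  also have "\<dots> = (\<Sum>k\<le>n. ?S k * (if k = 0 then 0 else r k * h (k - 1)))"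
    by (simp add: z)
  finally have 3: "(\<Sum>k\<le>Suc n. r (Suc k) * ?S (Suc k) * h k)
      = (\<Sum>k\<le>n. ?S k * (if k = 0 then 0 else r k * h (k - 1)))" .
  show ?thesis
    unfolding stieltjes_mat.simps distrib_left distrib_right sum.distrib 1 2 3
    by (simp add: algebra_simps)
qed

text \<open>Cut a closed path of length m + n at time m, at height k, and reverse its second half.
  Reversal exchanges rises and falls, which costs the factor r_1 ... r_k. The induction passes one
  step at a time across the cut, since J is symmetric with respect to these weights.\<close>

lemma stieltjes_mat_bilinear:
  "(\<Sum>k\<le>m. stieltjes_mat s r m k * ((\<Prod>i=1..k. r i) * stieltjes_mat s r n k))
    = stieltjes_mat s r (m + n) 0"
proof (induction m arbitrary: n)
  case 0
  then show ?case by simp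
next
  case (Suc m)
  let ?S = "stieltjes_mat s r" and ?R = "\<lambda>k. \<Prod>i=1..k. r i"
  have "(if k = 0 then 0 else r k * (?R (k - 1) * ?S n (k - 1))) + s k * (?R k * ?S n k)
      + ?R (Suc k) * ?S n (Suc k) = ?R k * ?S (Suc n) k" for k
    by (cases k) (simp_all add: algebra_simps)
  then show ?case
    unfolding sum_stieltjes_mat_Suc using Suc.IH[of "Suc n"] by simp
qed

section \<open>Convergents as generating functions of paths\<close>

section \<open>The continued fraction\<close>

text \<open>Last-passage decomposition: a path from 0 to \<open>k\<close> consists of excursions
  staying at or above i, one for each i \<le> k, joined by \<open>k\<close> rises. The products
  therefore obey the recurrence of the columns of the Stieltjes matrix. Passing to column
  \<open>Suc k\<close> costs a factor X, so the bound \<open>n + k < m\<close> is inherited and the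
  truncation is never felt.\<close>

lemma J_tail_product_nth:
  assumes "n + k < m"
  shows "fps_nth (fps_X ^ k * (\<Prod>i\<le>k. J_tail s r (m - i) i)) n = stieltjes_mat s r n k"
  using assms
proof (induction n arbitrary: k)
  define K where "K = (\<lambda>k. fps_X ^ k * (\<Prod>i\<le>k. J_tail s r (m - i) i))"
  have K_rec: "K k = (if k = 0 then 1 else 0) + fps_X * ((if k = 0 then 0 else K (k - 1))
      + fps_const (s k) * K k + fps_const (r (Suc k)) * K (Suc k))" if "k < m" for k
  proof -
    \<comment> \<open>As \<open>k < m\<close>, the tail at level \<open>k\<close> has positive
      depth, so its defining equation is available.\<close>
    define p where "p = m - Suc k"
    have p: "m - k = Suc p" "m - Suc k = p"
      using that by (simp_all add: p_def)
    define L where "L = fps_X ^ k * (\<Prod>i<k. J_tail s r (m - i) i)"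
    define J where "J = J_tail s r (Suc p) k"
    define J' where "J' = J_tail s r p (Suc k)"
    have K: "K k = L * J"
      unfolding K_def L_def J_def p(1)[symmetric] lessThan_Suc_atMost[symmetric] prod.lessThan_Suc
      by (rule mult.assoc[symmetric])
    have K': "K (Suc k) = fps_X * L * J * J'"
      unfolding K_def L_def J_def J'_def p(1)[symmetric] lessThan_Suc_atMost[symmetric]
        prod.lessThan_Suc power_Suc p(2)
      by (simp only: mult.assoc)
    have L: "L = (if k = 0 then 1 else fps_X * K (k - 1))"
      by (cases k) (simp_all add: K_def L_def lessThan_Suc_atMost mult.assoc del: J_tail.simps prod.lessThan_Suc)
    define E where "E = fps_const (s k) * fps_X + fps_const (r (Suc k)) * fps_X ^ 2 * J'"
    have "(1 - fps_const (s k) * fps_X - fps_const (r (Suc k)) * fps_X ^ 2 * J') * J = 1"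
      unfolding J_def J'_def by (rule J_tail_Suc_inverse)
    then have "(1 - E) * J = 1"
      by (simp only: E_def diff_diff_eq)
    \<comment> \<open>In this equation \<open>E\<close> collects the level step and the fall into
      height \<open>k\<close>; the summand 1, multiplied by \<open>L\<close>, becomes the start of
      the path or the rise from \<open>k - 1\<close>.\<close>
    then have "J = 1 + E * J"
      unfolding left_diff_distrib mult_1_left by (rule diff_eq_eq[THEN iffD1])
    then have "K k = L * (1 + E * J)"
      unfolding K by (rule arg_cong)
    also have "\<dots> = L + fps_X * (fps_const (s k) * K k + fps_const (r (Suc k)) * K (Suc k))"
      unfolding K K' E_def by (simp only: distrib_left mult_1_left mult_1_right power2_eq_square mult_ac)
    finally have "K k = L + fps_X * (fps_const (s k) * K k + fps_const (r (Suc k)) * K (Suc k))" .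
    then show ?thesis
      by (rule trans) (simp add: L algebra_simps)
  qed
  {
    case 0
    then have "k < m" by simp
    have "fps_nth (K k) 0 = stieltjes_mat s r 0 k"
      by (subst K_rec[OF \<open>k < m\<close>]) simp
    then show ?case by (simp only: K_def)
  next
    case (Suc n)
    have IH: "fps_nth (K k) n = stieltjes_mat s r n k" if "n + k < m" for k
      using Suc.IH[OF that] by (simp only: K_def)
    have "k < m" using Suc.prems by simp
    have "fps_nth (K k) (Suc n) = stieltjes_mat s r (Suc n) k"
      using Suc.prems by (subst K_rec[OF \<open>k < m\<close>]) (auto simp: IH)
    then show ?case by (simp only: K_def)
  }
qed

text \<open>Coefficient \<open>n\<close> of the convergents is stationary from depth
  \<open>n + 1\<close> on.\<close>

lemma has_J_fraction_stieltjes_mat: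
  "has_J_fraction (Abs_fps (\<lambda>n. stieltjes_mat s r n 0)) s r"
  unfolding has_J_fraction_def
proof (rule tendsto_fpsI)
  fix n
  have "fps_nth (J_tail s r m 0) n = stieltjes_mat s r n 0" if "n < m" for m
    using J_tail_product_nth[of n 0 m s r] that by simp
  then show "eventually (\<lambda>m. fps_nth (J_tail s r m 0) n
      = fps_nth (Abs_fps (\<lambda>n. stieltjes_mat s r n 0)) n) sequentially"
    by (intro eventually_mono[OF eventually_gt_at_top[of n]]) simp
qed

section \<open>Determinants from triangular and tridiagonal factors\<close>

section \<open>Hankel determinants\<close>

lemma det_unit_lower_triangular:
  fixes A :: "nat \<Rightarrow> nat \<Rightarrow> 'a::comm_ring_1"
  assumes "\<And>i j. i < j \<Longrightarrow> j < n \<Longrightarrow> A i j = 0"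
  shows "Determinant.det (Matrix.mat n n (\<lambda>(i, j). A i j)) = (\<Prod>i<n. A i i)"
proof -
  have "Determinant.det (Matrix.mat n n (\<lambda>(i, j). A i j))
      = prod_list (diag_mat (Matrix.mat n n (\<lambda>(i, j). A i j)))"
    by (rule det_lower_triangular[where n = n]) (use assms in auto)
  also have "diag_mat (Matrix.mat n n (\<lambda>(i, j). A i j)) = map (\<lambda>i. A i i) [0..<n]"
    by (auto simp: diag_mat_def)
  also have "prod_list \<dots> = (\<Prod>i<n. A i i)"
    by (simp add: prod.distinct_set_conv_list[symmetric] lessThan_atLeast0)
  finally show ?thesis .
qed

text \<open>The factor \<open>r i\<close> occurs in the inner products for k = i, ..., n - 1, that
  is, n - i times.\<close>

lemma prod_prod_atLeastAtMost:
  fixes r :: "nat \<Rightarrow> 'a::comm_monoid_mult"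
  shows "(\<Prod>k<n. \<Prod>i=1..k. r i) = (\<Prod>i=1..<n. r i ^ (n - i))"
proof (induction n)
  case 0
  then show ?case by simp
next
  case (Suc n)
  have "(\<Prod>i=1..<Suc n. r i ^ (Suc n - i)) = (\<Prod>i=1..<Suc n. r i ^ (n - i) * r i)"
    by (rule prod.cong) (auto simp: Suc_diff_le mult.commute)
  also have "\<dots> = (\<Prod>i=1..<Suc n. r i ^ (n - i)) * (\<Prod>i=1..<Suc n. r i)"
    by (rule prod.distrib)
  also have "(\<Prod>i=1..<Suc n. r i ^ (n - i)) = (\<Prod>i=1..<n. r i ^ (n - i))"
    by (cases n) simp_all
  finally show ?case
    using Suc.IH by (simp add: atLeastLessThanSuc_atLeastAtMost)
qed

lemma det_transposed_mult:
  fixes A B H :: "nat \<Rightarrow> nat \<Rightarrow> 'a::comm_ring_1"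
  assumes "\<And>i j. i < n \<Longrightarrow> j < n \<Longrightarrow> H i j = (\<Sum>k<n. A i k * B j k)"
  shows "Determinant.det (Matrix.mat n n (\<lambda>(i, j). H i j))
    = Determinant.det (Matrix.mat n n (\<lambda>(i, j). A i j)) * Determinant.det (Matrix.mat n n (\<lambda>(i, j). B i j))"
proof -
  let ?A = "Matrix.mat n n (\<lambda>(i, j). A i j)" and ?B = "Matrix.mat n n (\<lambda>(i, j). B i j)"
  have "Matrix.mat n n (\<lambda>(i, j). H i j) = ?A * transpose_mat ?B"
    by (rule eq_matI) (auto simp: assms scalar_prod_def lessThan_atLeast0)
  moreover have "Determinant.det (transpose_mat ?B) = Determinant.det ?B"
    by (rule det_transpose) auto
  ultimately show ?thesis
    by (simp add: det_mult[of _ n])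
qed

lemma sum_stieltjes_mat_extend:
  assumes "n < N"
  shows "(\<Sum>k<N. stieltjes_mat s r n k * h k) = (\<Sum>k\<le>n. stieltjes_mat s r n k * h k)"
  using assms by (intro sum.mono_neutral_right) (auto simp: stieltjes_mat_eq_0)

text \<open>This is the matrix J that carries row \<open>n\<close> of the Stieltjes matrix to row
  \<open>Suc n\<close> by multiplication from the right.\<close>

definition jacobi_entry :: "(nat \<Rightarrow> 'a::comm_ring_1) \<Rightarrow> (nat \<Rightarrow> 'a) \<Rightarrow> nat \<Rightarrow> nat \<Rightarrow> 'a" where
  "jacobi_entry s r i j =
     (if j = Suc i then 1 else if j = i then s i else if i = Suc j then r i else 0)"

text \<open>The last row has only two nonzero entries, so expansion along it gives the three-term
  recurrence of \<open>Q_seq\<close>.\<close>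

lemma det_jacobi:
  "Determinant.det (Matrix.mat n n (\<lambda>(i, j). jacobi_entry s r i j)) = Q_seq s r n"
proof (induction s r n rule: Q_seq.induct)
  case (1 s r)
  then show ?case by (simp add: det_dim_zero)
next
  case (2 s r)
  then show ?case by (subst det_single) (auto simp: jacobi_entry_def)
next
  case (3 s r n)
  define J where "J = (\<lambda>n. Matrix.mat n n (\<lambda>(i, j). jacobi_entry s r i j))"
  let ?A = "J (Suc (Suc n))"
  have A: "?A \<in> carrier_mat (Suc (Suc n)) (Suc (Suc n))"
    by (simp add: J_def)
  have "Determinant.det ?A
      = (\<Sum>j<Suc (Suc n). ?A $$ (Suc n, j) * cofactor ?A (Suc n) j)"
    by (rule laplace_expansion_row[OF A]) simp
  also have "\<dots> = r (Suc n) * cofactor ?A (Suc n) n + s (Suc n) * cofactor ?A (Suc n) (Suc n)"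
    by (simp add: J_def jacobi_entry_def)
  also have "cofactor ?A (Suc n) (Suc n) = Determinant.det (J (Suc n))"
  proof -
    have "mat_delete ?A (Suc n) (Suc n) = J (Suc n)"
      by (rule eq_matI) (auto simp: mat_delete_def J_def)
    then show ?thesis by (simp add: cofactor_def)
  qed
  also have "cofactor ?A (Suc n) n = - Determinant.det (J n)"
  proof -
    let ?M = "mat_delete ?A (Suc n) n"
    have M: "?M \<in> carrier_mat (Suc n) (Suc n)"
      by (auto simp: mat_delete_def J_def)
    \<comment> \<open>The last column of \<open>?M\<close> has the superdiagonal 1 as its only
      nonzero entry, at the bottom; the minus sign comes from the off-diagonal position in
      \<open>?A\<close>.\<close>
    have "Determinant.det ?M = (\<Sum>i<Suc n. ?M $$ (i, n) * cofactor ?M i n)"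
      by (rule laplace_expansion_column[OF M]) simp
    also have "\<dots> = cofactor ?M n n"
      by (auto simp: mat_delete_def J_def jacobi_entry_def)
    also have "mat_delete ?M n n = J n"
      by (rule eq_matI) (auto simp: mat_delete_def J_def)
    then have "cofactor ?M n n = Determinant.det (J n)"
      by (simp add: cofactor_def)
    finally show ?thesis by (simp add: cofactor_def)
  qed
  finally show ?case
    using 3 by (simp add: J_def algebra_simps)
qed

lemma hankel_det_stieltjes_mat:
  "Determinant.det (Matrix.mat n n (\<lambda>(i, j). stieltjes_mat s r (i + j) 0))
    = (\<Prod>i=1..<n. r i ^ (n - i))"
proof -
  let ?S = "stieltjes_mat s r" and ?R = "\<lambda>k. \<Prod>i=1..k. r i"
  have "Determinant.det (Matrix.mat n n (\<lambda>(i, j). ?S (i + j) 0))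
      = Determinant.det (Matrix.mat n n (\<lambda>(i, j). ?S i j))
        * Determinant.det (Matrix.mat n n (\<lambda>(i, j). ?R j * ?S i j))"
    by (rule det_transposed_mult) (simp only: sum_stieltjes_mat_extend stieltjes_mat_bilinear)
  then show ?thesis
    by (simp add: det_unit_lower_triangular stieltjes_mat_eq_0 stieltjes_mat_diag
        prod_prod_atLeastAtMost[unfolded One_nat_def])
qed

text \<open>The shifted Hankel matrix is S J R S^T. Row i of S ends at column i, so this product is
  exact on leading n x n sections, and J contributes the factor \<open>Q_seq s r n\<close>.\<close>

lemma hankel_det_Suc_stieltjes_mat:
  "Determinant.det (Matrix.mat n n (\<lambda>(i, j). stieltjes_mat s r (i + j + 1) 0))
    = (\<Prod>i=1..<n. r i ^ (n - i)) * Q_seq s r n"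
proof -
  let ?S = "stieltjes_mat s r" and ?R = "\<lambda>k. \<Prod>i=1..k. r i"
  have "Determinant.det (Matrix.mat n n (\<lambda>(i, j). ?S (i + j + 1) 0))
      = Determinant.det (Matrix.mat n n (\<lambda>(i, j). ?S (Suc i) j))
        * Determinant.det (Matrix.mat n n (\<lambda>(i, j). ?R j * ?S i j))"
  proof (rule det_transposed_mult)
    fix i j assume "i < n" "j < n"
    then have "(\<Sum>k<n. ?S j k * (?R k * ?S (Suc i) k)) = ?S (j + Suc i) 0"
      by (simp only: sum_stieltjes_mat_extend stieltjes_mat_bilinear)
    then show "?S (i + j + 1) 0 = (\<Sum>k<n. ?S (Suc i) k * (?R k * ?S j k))"
      by (simp add: mult_ac add_ac del: stieltjes_mat.simps)
  qed
  also have "Determinant.det (Matrix.mat n n (\<lambda>(i, j). ?S (Suc i) j))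
      = Determinant.det (Matrix.mat n n (\<lambda>(i, j). ?S i j))
        * Determinant.det (Matrix.mat n n (\<lambda>(i, j). jacobi_entry s r j i))"
  proof (rule det_transposed_mult)
    fix i j assume i: "i < n" "j < n"
    let ?\<delta> = "\<lambda>k. if k = j then 1 else (0::'a)"
    have "(\<Sum>k<n. ?S i k * jacobi_entry s r k j) = (\<Sum>k\<le>i. ?S i k * jacobi_entry s r k j)"
      using i by (simp add: sum_stieltjes_mat_extend)
    also have "\<dots> = (\<Sum>k\<le>i. ?S i k * ((if k = 0 then 0 else r k * ?\<delta> (k - 1)) + s k * ?\<delta> k + ?\<delta> (Suc k)))"
      by (rule sum.cong) (auto simp: jacobi_entry_def)
    also have "\<dots> = (\<Sum>k\<le>Suc i. ?S (Suc i) k * ?\<delta> k)"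
      by (rule sum_stieltjes_mat_Suc[symmetric])
    also have "\<dots> = (\<Sum>k\<in>{..Suc i}. if k = j then ?S (Suc i) k else 0)"
      by (rule sum.cong) auto
    also have "\<dots> = ?S (Suc i) j"
      using stieltjes_mat_eq_0[of "Suc i" j s r] by (subst sum.delta) (auto simp del: stieltjes_mat.simps)
    finally show "?S (Suc i) j = (\<Sum>k<n. ?S i k * jacobi_entry s r k j)" by simp
  qed
  also have "Determinant.det (Matrix.mat n n (\<lambda>(i, j). jacobi_entry s r j i)) = Q_seq s r n"
  proof -
    have "Matrix.mat n n (\<lambda>(i, j). jacobi_entry s r j i)
        = transpose_mat (Matrix.mat n n (\<lambda>(i, j). jacobi_entry s r i j))"
      by (rule eq_matI) auto
    then show ?thesis by (simp add: det_transpose[of _ n] det_jacobi)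
  qed
  finally show ?thesis
    by (simp add: det_unit_lower_triangular stieltjes_mat_eq_0 stieltjes_mat_diag
        prod_prod_atLeastAtMost[unfolded One_nat_def] mult.commute del: stieltjes_mat.simps)
qed

section \<open>Polynomials with nonnegative coefficients\<close>

lemma nonneg_coeffs_0: "nonneg_coeffs 0"
  by (simp add: nonneg_coeffs_def)

lemma nonneg_coeffs_1: "nonneg_coeffs 1"
  by (simp add: nonneg_coeffs_def lookup_one when_def)

lemma nonneg_coeffs_add: "nonneg_coeffs p \<Longrightarrow> nonneg_coeffs p' \<Longrightarrow> nonneg_coeffs (p + p')"
  by (simp add: nonneg_coeffs_def lookup_add)

lemma Sum_any_nonneg:
  fixes f :: "'b \<Rightarrow> real"
  assumes "\<And>x. 0 \<le> f x"
  shows "0 \<le> Sum_any f"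
  unfolding Sum_any.expand_set using assms by (rule sum_nonneg)

lemma nonneg_coeffs_mult: "nonneg_coeffs p \<Longrightarrow> nonneg_coeffs p' \<Longrightarrow> nonneg_coeffs (p * p')"
  unfolding nonneg_coeffs_def lookup_mult
  by (intro allI Sum_any_nonneg mult_nonneg_nonneg) (auto simp: when_def)

lemma nonneg_coeffs_power: "nonneg_coeffs p \<Longrightarrow> nonneg_coeffs (p ^ n)"
  by (induction n) (simp_all add: nonneg_coeffs_1 nonneg_coeffs_mult)

lemma nonneg_coeffs_of_nat: "nonneg_coeffs (of_nat n)"
  by (induction n) (simp_all add: nonneg_coeffs_0 nonneg_coeffs_1 nonneg_coeffs_add)

lemma nonneg_coeffs_prod: "(\<And>i. i \<in> A \<Longrightarrow> nonneg_coeffs (f i)) \<Longrightarrow> nonneg_coeffs (prod f A)"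
  by (induction A rule: infinite_finite_induct) (simp_all add: nonneg_coeffs_1 nonneg_coeffs_mult)

lemma nonneg_coeffs_mvar: "nonneg_coeffs (mvar x)"
  by (simp add: nonneg_coeffs_def mvar_def lookup_single when_def)

lemmas nonneg_coeffs_intros =
  nonneg_coeffs_0 nonneg_coeffs_1 nonneg_coeffs_add nonneg_coeffs_mult nonneg_coeffs_power
  nonneg_coeffs_of_nat nonneg_coeffs_prod nonneg_coeffs_mvar

section \<open>Total positivity by elementary row additions\<close>

section \<open>Operations that preserve total positivity\<close>

lemma x_totally_positiveD:
  assumes "x_totally_positive M" "strict_mono_on {..<n} \<rho>" "strict_mono_on {..<n} \<gamma>"
  shows "nonneg_coeffs (Determinant.det (Matrix.mat n n (\<lambda>(i, j). M (\<rho> i) (\<gamma> j))))"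
  using assms unfolding x_totally_positive_def by blast

lemma x_totally_positive_transpose:
  assumes "x_totally_positive M"
  shows "x_totally_positive (\<lambda>i j. M j i)"
  unfolding x_totally_positive_def
proof (intro allI impI)
  fix n :: nat and \<rho> \<gamma> :: "nat \<Rightarrow> nat"
  assume "strict_mono_on {..<n} \<rho>" "strict_mono_on {..<n} \<gamma>"
  then have "nonneg_coeffs (Determinant.det (Matrix.mat n n (\<lambda>(i, j). M (\<gamma> i) (\<rho> j))))"
    using x_totally_positiveD[OF assms] by blast
  also have "Determinant.det (Matrix.mat n n (\<lambda>(i, j). M (\<gamma> i) (\<rho> j)))
      = Determinant.det (transpose_mat (Matrix.mat n n (\<lambda>(i, j). M (\<gamma> i) (\<rho> j))))"
    by (rule det_transpose[symmetric]) auto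
  also have "transpose_mat (Matrix.mat n n (\<lambda>(i, j). M (\<gamma> i) (\<rho> j)))
      = Matrix.mat n n (\<lambda>(i, j). M (\<gamma> j) (\<rho> i))"
    by (rule eq_matI) auto
  finally show "nonneg_coeffs (Determinant.det (Matrix.mat n n (\<lambda>(i, j). M (\<gamma> j) (\<rho> i))))" .
qed

text \<open>The cofactors along row \<open>p\<close> do not see that row, so the expansion along it
  is linear in it.\<close>

lemma det_row_linear:
  fixes A B C :: "nat \<Rightarrow> nat \<Rightarrow> 'a::comm_ring_1"
  assumes p: "p < n"
    and A: "\<And>i j. i < n \<Longrightarrow> j < n \<Longrightarrow> i \<noteq> p \<Longrightarrow> A i j = B i j \<and> C i j = B i j"
    and row: "\<And>j. j < n \<Longrightarrow> A p j = B p j + c * C p j"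
  shows "Determinant.det (Matrix.mat n n (\<lambda>(i, j). A i j))
    = Determinant.det (Matrix.mat n n (\<lambda>(i, j). B i j)) + c * Determinant.det (Matrix.mat n n (\<lambda>(i, j). C i j))"
proof -
  let ?M = "\<lambda>A. Matrix.mat n n (\<lambda>(i, j). A i j)"
  have expand: "Determinant.det (?M X) = (\<Sum>j<n. X p j * cofactor (?M X) p j)" for X :: "nat \<Rightarrow> nat \<Rightarrow> 'a"
    by (subst laplace_expansion_row[where n = n and i = p]) (use p in auto)
  have cof: "cofactor (?M X) p j = cofactor (?M B) p j"
    if "\<And>i j. i < n \<Longrightarrow> j < n \<Longrightarrow> i \<noteq> p \<Longrightarrow> X i j = B i j" for X j
  proof -
    have "mat_delete (?M X) p j = mat_delete (?M B) p j"
      unfolding mat_delete_def by (rule eq_matI) (auto simp: that)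
    then show ?thesis by (simp add: cofactor_def)
  qed
  have cof_A: "cofactor (?M A) p j = cofactor (?M B) p j" for j
    by (rule cof) (use A in blast)
  have cof_C: "cofactor (?M C) p j = cofactor (?M B) p j" for j
    by (rule cof) (use A in blast)
  have "Determinant.det (?M A) = (\<Sum>j<n. (B p j + c * C p j) * cofactor (?M B) p j)"
    unfolding expand[of A] cof_A by (rule sum.cong) (auto simp: row)
  also have "\<dots> = (\<Sum>j<n. B p j * cofactor (?M B) p j) + c * (\<Sum>j<n. C p j * cofactor (?M B) p j)"
    by (simp only: distrib_right sum.distrib sum_distrib_left mult.assoc)
  also have "\<dots> = Determinant.det (?M B) + c * Determinant.det (?M C)"
    unfolding expand[of B] expand[of C] cof_C ..
  finally show ?thesis .
qed

lemma strict_mono_on_replace_pred: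
  fixes \<rho> :: "nat \<Rightarrow> nat"
  assumes "strict_mono_on {..<n} \<rho>" "p < n" "\<rho> p = Suc t" "t \<notin> \<rho> ` {..<n}"
  shows "strict_mono_on {..<n} (\<rho>(p := t))"
proof (rule strict_mono_onI)
  fix i j assume ij: "i \<in> {..<n}" "j \<in> {..<n}" "i < j"
  then have "\<rho> i < \<rho> j" using assms(1) unfolding strict_mono_on_def by blast
  moreover have "\<rho> i \<noteq> t" using assms(4) ij by blast
  ultimately show "(\<rho>(p := t)) i < (\<rho>(p := t)) j"
    using assms(3) ij by auto
qed

text \<open>By linearity in the changed row, a minor gains \<open>c\<close> times the same minor
  with row index \<open>Suc t\<close> replaced by \<open>t\<close>. Since the indices are adjacent,
  the selection is still increasing, or else row \<open>t\<close> occurs twice and the determinant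
  is 0.\<close>

lemma x_totally_positive_add_row:
  assumes tp: "x_totally_positive M" and c: "nonneg_coeffs c"
  shows "x_totally_positive (\<lambda>i j. M i j + (if i = Suc t then c * M t j else 0))"
    (is "x_totally_positive ?M'")
  unfolding x_totally_positive_def
proof (intro allI impI)
  fix n :: nat and \<rho> \<gamma> :: "nat \<Rightarrow> nat"
  assume \<rho>: "strict_mono_on {..<n} \<rho>" and \<gamma>: "strict_mono_on {..<n} \<gamma>"
  let ?D = "\<lambda>M \<rho>. Determinant.det (Matrix.mat n n (\<lambda>(i, j). M (\<rho> i) (\<gamma> j)))"
  show "nonneg_coeffs (?D ?M' \<rho>)"
  proof (cases "Suc t \<in> \<rho> ` {..<n}")
    case False
    then have "\<rho> i \<noteq> Suc t" if "i < n" for i using that by (metis image_eqI lessThan_iff)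
    then have "Matrix.mat n n (\<lambda>(i, j). ?M' (\<rho> i) (\<gamma> j)) = Matrix.mat n n (\<lambda>(i, j). M (\<rho> i) (\<gamma> j))"
      by (intro eq_matI) auto
    then show ?thesis using x_totally_positiveD[OF tp \<rho> \<gamma>] by simp
  next
    case True
    then obtain p where p: "p < n" "\<rho> p = Suc t" by auto
    have inj: "i = j" if "i < n" "j < n" "\<rho> i = \<rho> j" for i j
      using strict_mono_on_imp_inj_on[OF \<rho>] that by (auto dest: inj_onD)
    have "?D ?M' \<rho> = ?D M \<rho> + c * ?D M (\<rho>(p := t))"
      by (rule det_row_linear[where p = p]) (use p inj in auto)
    moreover have "nonneg_coeffs (?D M (\<rho>(p := t)))"
    proof (cases "t \<in> \<rho> ` {..<n}")
      case True
      then obtain i where i: "i < n" "\<rho> i = t" by auto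
      have "i \<noteq> p" using i p by auto
      have "?D M (\<rho>(p := t)) = 0"
        by (rule det_identical_rows[where i = i and j = p and n = n])
          (use i p \<open>i \<noteq> p\<close> in \<open>auto intro!: eq_vecI\<close>)
      then show ?thesis by (simp only: nonneg_coeffs_0)
    next
      case False
      then show ?thesis
        using x_totally_positiveD[OF tp strict_mono_on_replace_pred[OF \<rho> p] \<gamma>] by blast
    qed
    ultimately show ?thesis
      using x_totally_positiveD[OF tp \<rho> \<gamma>] c by (simp add: nonneg_coeffs_intros)
  qed
qed

text \<open>Each minor involves finitely many rows. This allows passage to the limit of infinitely
  many row operations.\<close>

lemma x_totally_positive_if_initial_rows:
  assumes "\<And>N. \<exists>M'. x_totally_positive M' \<and> (\<forall>i<N. \<forall>j. M i j = M' i j)"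
  shows "x_totally_positive M"
  unfolding x_totally_positive_def
proof (intro allI impI)
  fix n :: nat and \<rho> \<gamma> :: "nat \<Rightarrow> nat"
  assume mono: "strict_mono_on {..<n} \<rho>" "strict_mono_on {..<n} \<gamma>"
  obtain N where N: "\<And>i. i < n \<Longrightarrow> \<rho> i < N"
  proof -
    have "finite (\<rho> ` {..<n})" by simp
    then obtain N where "\<forall>x\<in>\<rho> ` {..<n}. x < N" unfolding finite_nat_set_iff_bounded by blast
    then show ?thesis using that by blast
  qed
  obtain M' where M': "x_totally_positive M'" "\<forall>i<N. \<forall>j. M i j = M' i j"
    using assms by blast
  have "Matrix.mat n n (\<lambda>(i, j). M (\<rho> i) (\<gamma> j)) = Matrix.mat n n (\<lambda>(i, j). M' (\<rho> i) (\<gamma> j))"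
    using M'(2) N by (intro eq_matI) auto
  then show "nonneg_coeffs (Determinant.det (Matrix.mat n n (\<lambda>(i, j). M (\<rho> i) (\<gamma> j))))"
    using x_totally_positiveD[OF M'(1) mono] by simp
qed

text \<open>The row additions are carried out from row \<open>N\<close> upwards to row 1, so that
  row \<open>i - 1\<close> is still unchanged when it is added to row \<open>i\<close>;
  \<open>d\<close> counts the rows already treated.\<close>

lemma x_totally_positive_bidiagonal:
  assumes tp: "x_totally_positive M" and c: "\<And>i. nonneg_coeffs (c i)"
  shows "x_totally_positive (\<lambda>i j. M i j + (if i = 0 then 0 else c i * M (i - 1) j))"
proof (rule x_totally_positive_if_initial_rows)
  fix N
  have "x_totally_positive (\<lambda>i j. M i j + (if N - d < i \<and> i \<le> N then c i * M (i - 1) j else 0))"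
    if "d \<le> N" for d
    using that
  proof (induction d)
    case 0
    have "(\<lambda>i j. M i j + (if N - 0 < i \<and> i \<le> N then c i * M (i - 1) j else 0)) = M"
      by (intro ext) auto
    then show ?case using tp by (simp only:)
  next
    case (Suc d)
    obtain t where t: "N - d = Suc t" "N - Suc d = t"
      using Suc.prems by (metis Suc_diff_Suc Suc_le_lessD)
    have "x_totally_positive (\<lambda>i j. M i j + (if N - d < i \<and> i \<le> N then c i * M (i - 1) j else 0)
        + (if i = Suc t then c (Suc t) * (M t j + (if N - d < t \<and> t \<le> N then c t * M (t - 1) j else 0)) else 0))"
      by (rule x_totally_positive_add_row) (use Suc c in auto)
    moreover have "(\<lambda>i j. M i j + (if N - d < i \<and> i \<le> N then c i * M (i - 1) j else 0)
        + (if i = Suc t then c (Suc t) * (M t j + (if N - d < t \<and> t \<le> N then c t * M (t - 1) j else 0)) else 0))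
      = (\<lambda>i j. M i j + (if N - Suc d < i \<and> i \<le> N then c i * M (i - 1) j else 0))"
      using t by (intro ext) auto
    ultimately show ?case by simp
  qed
  from this[OF order_refl] show "\<exists>M'. x_totally_positive M' \<and>
      (\<forall>i<N. \<forall>j. M i j + (if i = 0 then 0 else c i * M (i - 1) j) = M' i j)"
    by (intro exI conjI, assumption) auto
qed

text \<open>If some selected row index is not a selected column index, the minor has a zero row.
  Otherwise both selections enumerate the same set in increasing order, hence coincide, and the
  minor is a product of diagonal entries.\<close>

lemma x_totally_positive_diagonal:
  assumes R: "\<And>k. nonneg_coeffs (R k)"
  shows "x_totally_positive (\<lambda>i j. if i = j then R j else 0)"
  unfolding x_totally_positive_def
proof (intro allI impI)
  fix n :: nat and \<rho> \<gamma> :: "nat \<Rightarrow> nat"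
  assume \<rho>: "strict_mono_on {..<n} \<rho>" and \<gamma>: "strict_mono_on {..<n} \<gamma>"
  let ?A = "Matrix.mat n n (\<lambda>(i, j). if \<rho> i = \<gamma> j then R (\<gamma> j) else 0)"
  show "nonneg_coeffs (Determinant.det ?A)"
  proof (cases "\<rho> ` {..<n} \<subseteq> \<gamma> ` {..<n}")
    case False
    then obtain p where p: "p < n" "\<rho> p \<notin> \<gamma> ` {..<n}" by auto
    have "Determinant.det ?A = (\<Sum>j<n. ?A $$ (p, j) * cofactor ?A p j)"
      by (rule laplace_expansion_row) (use p in auto)
    also have "\<dots> = 0"
      using p by (intro sum.neutral) auto
    finally show ?thesis by (simp add: nonneg_coeffs_0)
  next
    case True
    have "\<rho> i = \<gamma> i" if "i < n" for i
    proof -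
      have card: "card (\<rho> ` {..<n}) = n" "card (\<gamma> ` {..<n}) = n"
        using strict_mono_on_imp_inj_on[OF \<rho>] strict_mono_on_imp_inj_on[OF \<gamma>]
        by (simp_all add: card_image)
      then have im: "\<rho> ` {..<n} = \<gamma> ` {..<n}"
        using True by (intro card_subset_eq) auto
      have "map \<rho> [0..<n] = map \<gamma> [0..<n]"
      proof (rule sorted_distinct_set_unique)
        have "sorted (map f [0..<n])" if "strict_mono_on {..<n} f" for f :: "nat \<Rightarrow> nat"
          using that by (auto simp: sorted_iff_nth_mono_less strict_mono_on_def intro: less_imp_le)
        then show "sorted (map \<rho> [0..<n])" "sorted (map \<gamma> [0..<n])"
          using \<rho> \<gamma> by blast+
        show "distinct (map \<rho> [0..<n])" "distinct (map \<gamma> [0..<n])"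
          using strict_mono_on_imp_inj_on[OF \<rho>] strict_mono_on_imp_inj_on[OF \<gamma>]
          by (simp_all add: distinct_map lessThan_atLeast0)
        show "set (map \<rho> [0..<n]) = set (map \<gamma> [0..<n])"
          using im by (simp add: lessThan_atLeast0)
      qed
      then show ?thesis using that by (simp add: map_eq_conv)
    qed
    then have "?A = Matrix.mat n n (\<lambda>(i, j). if i = j then R (\<gamma> j) else 0)"
      using strict_mono_on_imp_inj_on[OF \<gamma>] by (intro eq_matI) (auto dest: inj_onD)
    moreover have "Determinant.det \<dots> = prod_list (diag_mat \<dots>)"
      by (rule det_lower_triangular[where n = n]) auto
    moreover have "nonneg_coeffs (prod_list (diag_mat (Matrix.mat n n (\<lambda>(i, j). if i = j then R (\<gamma> j) else 0))))"
    proof -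
      have prod_list: "nonneg_coeffs (prod_list xs)" if "\<And>x. x \<in> set xs \<Longrightarrow> nonneg_coeffs x" for xs
        using that by (induction xs) (auto intro: nonneg_coeffs_intros)
      show ?thesis by (rule prod_list) (auto simp: diag_mat_def R)
    qed
    ultimately show ?thesis by simp
  qed
qed

text \<open>Only the lower triangle of \<open>A\<close> is read. Stating the property through the
  action on \<open>M\<close> makes closure under products a matter of composition, without the
  Cauchy-Binet formula.\<close>

definition tp_preserving :: "(nat \<Rightarrow> nat \<Rightarrow> 'x mpoly) \<Rightarrow> bool" where
  "tp_preserving A \<longleftrightarrow>
     (\<forall>M. x_totally_positive M \<longrightarrow> x_totally_positive (\<lambda>i j. \<Sum>k\<le>i. A i k * M k j))"

text \<open>Triangularity of \<open>B\<close> lets the inner sum run up to \<open>i\<close> instead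
  of \<open>l\<close>, so that the two sums can be exchanged.\<close>

lemma tp_preserving_mult:
  fixes A B :: "nat \<Rightarrow> nat \<Rightarrow> 'x mpoly"
  assumes A: "tp_preserving A" and B: "tp_preserving B" and tri: "\<And>l k. l < k \<Longrightarrow> B l k = 0"
  shows "tp_preserving (\<lambda>i k. \<Sum>l\<le>i. A i l * B l k)"
  unfolding tp_preserving_def
proof (intro allI impI)
  fix M :: "nat \<Rightarrow> nat \<Rightarrow> 'x mpoly" assume "x_totally_positive M"
  then have "x_totally_positive (\<lambda>i j. \<Sum>l\<le>i. A i l * (\<Sum>k\<le>l. B l k * M k j))"
    using A B unfolding tp_preserving_def by blast
  moreover have "(\<Sum>l\<le>i. A i l * (\<Sum>k\<le>l. B l k * M k j)) = (\<Sum>k\<le>i. (\<Sum>l\<le>i. A i l * B l k) * M k j)" for i j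
  proof -
    have "(\<Sum>k\<le>l. B l k * M k j) = (\<Sum>k\<le>i. B l k * M k j)" if "l \<le> i" for l
      using that by (intro sum.mono_neutral_left) (auto simp: tri)
    then have "(\<Sum>l\<le>i. A i l * (\<Sum>k\<le>l. B l k * M k j)) = (\<Sum>l\<le>i. \<Sum>k\<le>i. A i l * B l k * M k j)"
      by (intro sum.cong) (auto simp: sum_distrib_left mult.assoc)
    then show ?thesis
      by (subst (asm) sum.swap) (simp add: sum_distrib_right)
  qed
  ultimately show "x_totally_positive (\<lambda>i j. \<Sum>k\<le>i. (\<Sum>l\<le>i. A i l * B l k) * M k j)"
    by simp
qed

definition row_step :: "(nat \<Rightarrow> 'a::comm_ring_1) \<Rightarrow> (nat \<Rightarrow> 'a) \<Rightarrow> (nat \<Rightarrow> nat \<Rightarrow> 'a) \<Rightarrow> nat \<Rightarrow> nat \<Rightarrow> 'a" where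
  "row_step s r M k j = (if k = 0 then 0 else r k * M (k - 1) j) + s k * M k j + M (Suc k) j"

text \<open>\<open>row_step\<close> is multiplication by J from the left, and row 0 of J^n is row
  \<open>n\<close> of the Stieltjes matrix.\<close>

lemma row_step_funpow_0:
  "(row_step s r ^^ n) M 0 j = (\<Sum>k\<le>n. stieltjes_mat s r n k * M k j)"
proof (induction n arbitrary: M)
  case 0
  then show ?case by simp
next
  case (Suc n)
  show ?case
    unfolding sum_stieltjes_mat_Suc funpow_Suc_right o_apply Suc.IH by (simp only: row_step_def)
qed

text \<open>
  Stacking the row \<open>(1, 0, 0, \<dots>)\<close> on top of the tridiagonal matrix with diagonal \<open>e k + f k\<close>,
  superdiagonal 1 and subdiagonal \<open>f k * e (k - 1)\<close> gives a product of two lower bidiagonal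
  matrices with unit diagonal and subdiagonals \<open>f\<close> and \<open>e\<close>. The Stieltjes matrix is the limit of
  products of such stacks, the \<open>m\<close>-th of them acting on the rows from \<open>m\<close> on.
\<close>

lemma tp_preserving_stieltjes_mat:
  fixes e f :: "nat \<Rightarrow> 'x mpoly"
  assumes e: "\<And>k. nonneg_coeffs (e k)" and f: "\<And>k. nonneg_coeffs (f k)"
  shows "tp_preserving (stieltjes_mat (\<lambda>k. e k + f k) (\<lambda>k. f k * e (k - 1)))"
  unfolding tp_preserving_def
proof (intro allI impI)
  fix M :: "nat \<Rightarrow> nat \<Rightarrow> 'x mpoly"
  assume tp: "x_totally_positive M"
  let ?P = "row_step (\<lambda>k. e k + f k) (\<lambda>k. f k * e (k - 1))"
  \<comment> \<open>After \<open>m\<close> stacks, rows 0 to \<open>m\<close> are final, and the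
    rows from \<open>m\<close> on are those of J^m M.\<close>
  let ?A = "\<lambda>m i. if i \<le> m then (?P ^^ i) M 0 else (?P ^^ m) M (i - m)"
  have A: "x_totally_positive (?A m)" for m
  proof (induction m)
    case 0
    have "?A 0 = M" by (rule ext) auto
    then show ?case using tp by (simp only:)
  next
    case (Suc m)
    \<comment> \<open>Adding \<open>e\<close>-multiples and then \<open>f\<close>-multiples of
      preceding rows realises one tridiagonal step: the second addition uses rows already changed by
      the first, whence the products \<open>f k * e (k - 1)\<close>. Row \<open>m\<close> stays
      fixed.\<close>
    let ?c = "\<lambda>i. if m < i then e (i - Suc m) else 0"
    let ?d = "\<lambda>i. if m < i then f (i - Suc m) else 0"
    let ?G = "\<lambda>i j. ?A m i j + (if i = 0 then 0 else ?c i * ?A m (i - 1) j)"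
    have "x_totally_positive ?G"
      by (rule x_totally_positive_bidiagonal[OF Suc.IH]) (auto simp: e nonneg_coeffs_0)
    then have "x_totally_positive (\<lambda>i j. ?G i j + (if i = 0 then 0 else ?d i * ?G (i - 1) j))"
      by (rule x_totally_positive_bidiagonal) (auto simp: f nonneg_coeffs_0)
    moreover have "?G i j + (if i = 0 then 0 else ?d i * ?G (i - 1) j) = ?A (Suc m) i j" for i j
    proof (cases "i \<le> m")
      case True
      then show ?thesis by auto
    next
      case False
      then obtain k where k: "i = Suc m + k"
        using le_Suc_ex[of "Suc m" i] by auto
      define h where "h = (?P ^^ m) M"
      have G1: "?G i j = h (Suc k) j + e k * h k j"
        by (cases k) (simp_all add: k h_def)
      have G2: "?G (i - 1) j = h k j + (if k = 0 then 0 else e (k - 1) * h (k - 1) j)"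
        by (cases k) (auto simp: k h_def)
      have "?A (Suc m) i j = ?P h k j"
        by (cases k) (simp_all add: k h_def)
      also have "\<dots> = (h (Suc k) j + e k * h k j) + f k * (h k j + (if k = 0 then 0 else e (k - 1) * h (k - 1) j))"
        by (simp add: row_step_def algebra_simps)
      finally show ?thesis
        unfolding G1 G2 by (simp add: k)
    qed
    ultimately show ?case by (simp only:)
  qed
  show "x_totally_positive (\<lambda>i j. \<Sum>k\<le>i. stieltjes_mat (\<lambda>k. e k + f k) (\<lambda>k. f k * e (k - 1)) i k * M k j)"
  proof (rule x_totally_positive_if_initial_rows)
    fix N
    show "\<exists>M'. x_totally_positive M' \<and> (\<forall>i<N. \<forall>j.
        (\<Sum>k\<le>i. stieltjes_mat (\<lambda>k. e k + f k) (\<lambda>k. f k * e (k - 1)) i k * M k j) = M' i j)"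
      by (rule exI[of _ "?A N"]) (auto simp: A row_step_funpow_0[symmetric])
  qed
qed

text \<open>This is row 0 of (J + a I)^n expanded by the binomial theorem: the matrix with constant
  diagonal \<open>a\<close> and no falls has entries binomial(n, l) a^(n - l).\<close>

lemma stieltjes_mat_add_diagonal:
  "stieltjes_mat (\<lambda>k. s k + a) r n k
    = (\<Sum>l\<le>n. stieltjes_mat (\<lambda>_. a) (\<lambda>_. 0) n l * stieltjes_mat s r l k)"
proof (induction n arbitrary: k)
  case 0
  then show ?case by simp
next
  case (Suc n)
  show ?case
    unfolding sum_stieltjes_mat_Suc stieltjes_mat.simps(2)[of "\<lambda>k. s k + a"] Suc.IH
    by (cases k) (simp_all add: algebra_simps sum.distrib sum_distrib_left cong: if_cong)
qed

text \<open>In S R S^T the diagonal R is totally positive; apply S, transpose, and apply S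
  again.\<close>

lemma x_totally_positive_hankel:
  assumes S: "tp_preserving (stieltjes_mat s r)" and r: "\<And>k. nonneg_coeffs (r k)"
  shows "x_totally_positive (\<lambda>i j. stieltjes_mat s r (i + j) 0)"
proof -
  let ?S = "stieltjes_mat s r" and ?R = "\<lambda>k. \<Prod>i=1..k. r i"
  have "x_totally_positive (\<lambda>i j. if i = j then ?R j else 0)"
    by (rule x_totally_positive_diagonal) (simp add: nonneg_coeffs_prod r)
  then have "x_totally_positive (\<lambda>i j. \<Sum>k\<le>i. ?S i k * (if k = j then ?R j else 0))"
    using S unfolding tp_preserving_def by blast
  also have "(\<lambda>i j. \<Sum>k\<le>i. ?S i k * (if k = j then ?R j else 0)) = (\<lambda>i j. ?R j * ?S i j)"
  proof (intro ext)
    fix i j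
    have "(\<Sum>k\<le>i. ?S i k * (if k = j then ?R j else 0)) = (\<Sum>k\<le>i. if k = j then ?S i k * ?R k else 0)"
      by (rule sum.cong) auto
    then show "(\<Sum>k\<le>i. ?S i k * (if k = j then ?R j else 0)) = ?R j * ?S i j"
      by (simp add: stieltjes_mat_eq_0 mult.commute)
  qed
  finally have "x_totally_positive (\<lambda>i j. ?R i * ?S j i)"
    by (rule x_totally_positive_transpose)
  then have "x_totally_positive (\<lambda>i j. \<Sum>k\<le>i. ?S i k * (?R k * ?S j k))"
    using S unfolding tp_preserving_def by blast
  then show ?thesis
    by (simp only: stieltjes_mat_bilinear)
qed

lemma x_Stieltjes_moment_T_poly:
  fixes a1 a2 b1 b2 lam q :: "'x mpoly"
  assumes "nonneg_coeffs a1" "nonneg_coeffs a2" "nonneg_coeffs b1" "nonneg_coeffs b2"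
    "nonneg_coeffs lam" "nonneg_coeffs q"
  shows "x_Stieltjes_moment (T_poly a1 a2 b1 b2 lam q)"
proof -
  \<comment> \<open>The shift to \<open>Suc n\<close> makes \<open>e (n - 1)\<close> carry the
    factor b1 n + b2 of \<open>r_seq\<close>; the other factors form \<open>f n\<close>. The sum of
    \<open>e\<close> and \<open>f\<close> then misses \<open>s_seq\<close> only by
    \<open>a2\<close>.\<close>
  define e where "e = (\<lambda>n. (b1 * of_nat (Suc n) + b2) * (q + lam))"
  define f where "f = (\<lambda>n. of_nat n * (b1 * (q + lam) + a1))"
  have ef: "nonneg_coeffs (e n)" "nonneg_coeffs (f n)" for n
    using assms by (auto simp: e_def f_def intro!: nonneg_coeffs_intros simp del: of_nat_Suc)
  have s: "s_seq a1 a2 b1 b2 lam q = (\<lambda>n. (e n + f n) + a2)"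
    by (rule ext) (simp add: s_seq_def e_def f_def algebra_simps)
  have r: "r_seq a1 b1 b2 lam q = (\<lambda>n. f n * e (n - 1))"
  proof
    fix n
    show "r_seq a1 b1 b2 lam q n = f n * e (n - 1)"
      by (cases n) (simp_all add: r_seq_def e_def f_def mult_ac)
  qed
  \<comment> \<open>The binomial transform is the instance with \<open>e\<close> constantly 0 and
    \<open>f\<close> constantly \<open>a2\<close>.\<close>
  have "tp_preserving (stieltjes_mat (\<lambda>k. 0 + a2) (\<lambda>k. a2 * 0))"
    by (rule tp_preserving_stieltjes_mat) (use assms in \<open>auto simp: nonneg_coeffs_0\<close>)
  then have "tp_preserving (stieltjes_mat (\<lambda>_. a2) (\<lambda>_. 0))" by simp
  then have "tp_preserving (\<lambda>n k. \<Sum>l\<le>n. stieltjes_mat (\<lambda>_. a2) (\<lambda>_. 0) n l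
      * stieltjes_mat (\<lambda>n. e n + f n) (\<lambda>n. f n * e (n - 1)) l k)"
    by (rule tp_preserving_mult[OF _ tp_preserving_stieltjes_mat]) (auto simp: ef stieltjes_mat_eq_0)
  then have "tp_preserving (stieltjes_mat (\<lambda>n. (e n + f n) + a2) (\<lambda>n. f n * e (n - 1)))"
    by (simp only: stieltjes_mat_add_diagonal[symmetric])
  then have "x_totally_positive (\<lambda>i j. stieltjes_mat (\<lambda>n. (e n + f n) + a2) (\<lambda>n. f n * e (n - 1)) (i + j) 0)"
    by (rule x_totally_positive_hankel) (intro nonneg_coeffs_mult ef)
  then show ?thesis
    unfolding x_Stieltjes_moment_def T_poly_eq_stieltjes_mat s r .
qed

section \<open>Iterates of \<open>LC\<close> as subtraction-free expressions in Hankel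
  minors\<close>

section \<open>Log-convexity\<close>

text \<open>Expansion along the first row, with the minors again given by entry functions, so that
  rewriting can expand small determinants completely.\<close>

lemma det_mat_Suc:
  fixes A :: "nat \<Rightarrow> nat \<Rightarrow> 'a::comm_ring_1"
  shows "Determinant.det (Matrix.mat (Suc n) (Suc n) (\<lambda>(i, j). A i j))
    = (\<Sum>j<Suc n. (-1) ^ j * A 0 j
        * Determinant.det (Matrix.mat n n (\<lambda>(i, k). A (Suc i) (if k < j then k else Suc k))))"
proof -
  let ?A = "Matrix.mat (Suc n) (Suc n) (\<lambda>(i, j). A i j)"
  have "Determinant.det ?A = (\<Sum>j<Suc n. ?A $$ (0, j) * cofactor ?A 0 j)"
    by (rule laplace_expansion_row) auto
  also have "\<dots> = (\<Sum>j<Suc n. (-1) ^ j * A 0 j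
        * Determinant.det (Matrix.mat n n (\<lambda>(i, k). A (Suc i) (if k < j then k else Suc k))))"
  proof (intro sum.cong refl)
    fix j assume j: "j \<in> {..<Suc n}"
    have "mat_delete ?A 0 j = Matrix.mat n n (\<lambda>(i, k). A (Suc i) (if k < j then k else Suc k))"
      by (rule eq_matI) (auto simp: mat_delete_def)
    then show "?A $$ (0, j) * cofactor ?A 0 j = (-1) ^ j * A 0 j
        * Determinant.det (Matrix.mat n n (\<lambda>(i, k). A (Suc i) (if k < j then k else Suc k)))"
      using j by (simp add: cofactor_def mult_ac)
  qed
  finally show ?thesis .
qed

definition hankel_minor :: "(nat \<Rightarrow> 'a::comm_ring_1) \<Rightarrow> nat \<Rightarrow> nat \<Rightarrow> 'a" where
  "hankel_minor f n a = Determinant.det (Matrix.mat n n (\<lambda>(i, j). f (a + i + j)))"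

lemma hankel_minor_1: "hankel_minor f (Suc 0) a = f a"
  unfolding hankel_minor_def det_mat_Suc by simp

lemma hankel_minor_2: "hankel_minor f 2 a = f a * f (a + 2) - f (a + 1) ^ 2"
  unfolding hankel_minor_def numeral_2_eq_2 det_mat_Suc
  by (simp add: power2_eq_square)

lemma hankel_minor_3:
  "hankel_minor f 3 a = f a * (f (a + 2) * f (a + 4) - f (a + 3) * f (a + 3))
    - f (a + 1) * (f (a + 1) * f (a + 4) - f (a + 3) * f (a + 2))
    + f (a + 2) * (f (a + 1) * f (a + 3) - f (a + 2) * f (a + 2))"
  unfolding hankel_minor_def numeral_3_eq_3 det_mat_Suc
  by (simp add: eval_nat_numeral)

text \<open>Desnanot-Jacobi for the 3 x 3 Hankel matrix: its corner minors are values of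
  \<open>LC f\<close>, and its central entry is \<open>f (a + 2)\<close>.\<close>

lemma LC_2: "(LC ^^ 2) f (a + 2) = f (a + 2) * hankel_minor f 3 a"
  unfolding hankel_minor_3
  by (simp add: LC_def numeral_2_eq_2 eval_nat_numeral) (simp add: algebra_simps)

text \<open>The Desnanot--Jacobi identity for a symmetric \<open>4 \<times> 4\<close> Hankel matrix.\<close>

lemma hankel_condensation:
  fixes p0 p1 p2 p3 p4 p5 p6 :: "'a::comm_ring_1"
  shows "(p0 * (p2 * (p4 * p6 - p5 * p5) - p3 * (p3 * p6 - p5 * p4) + p4 * (p3 * p5 - p4 * p4))
      - p1 * (p1 * (p4 * p6 - p5 * p5) - p3 * (p2 * p6 - p5 * p3) + p4 * (p2 * p5 - p4 * p3))
      + p2 * (p1 * (p3 * p6 - p5 * p4) - p2 * (p2 * p6 - p5 * p3) + p4 * (p2 * p4 - p3 * p3))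
      - p3 * (p1 * (p3 * p5 - p4 * p4) - p2 * (p2 * p5 - p4 * p3) + p3 * (p2 * p4 - p3 * p3)))
      * (p2 * p4 - p3 ^ 2)
    = (p0 * (p2 * p4 - p3 * p3) - p1 * (p1 * p4 - p3 * p2) + p2 * (p1 * p3 - p2 * p2))
      * (p2 * (p4 * p6 - p5 * p5) - p3 * (p3 * p6 - p5 * p4) + p4 * (p3 * p5 - p4 * p4))
      - (p1 * (p3 * p5 - p4 * p4) - p2 * (p2 * p5 - p4 * p3) + p3 * (p2 * p4 - p3 * p3)) ^ 2"
  by (simp only: power2_eq_square algebra_simps)

text \<open>By \<open>LC_2\<close> the third iterate is a difference of products of 3 x 3 minors.
  Condensation \<open>D\<close> rewrites the product of the outer two, and the remaining difference
  f(a+2) f(a+4) - f(a+3)^2 is itself a minor, so no subtraction is left.\<close>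

lemma LC_3:
  "(LC ^^ 3) f (a + 3) = f (a + 2) * f (a + 4) * hankel_minor f 2 (a + 2) * hankel_minor f 4 a
    + hankel_minor f 2 (a + 2) * hankel_minor f 3 (a + 1) ^ 2"
proof -
  have D: "hankel_minor f 4 a * hankel_minor f 2 (a + 2)
      = hankel_minor f 3 a * hankel_minor f 3 (a + 2) - hankel_minor f 3 (a + 1) ^ 2"
  proof -
    define p where "p = (\<lambda>k. f (a + k))"
    have minors: "hankel_minor f 2 (a + 2) = p 2 * p 4 - p 3 ^ 2"
      "hankel_minor f 3 a = p 0 * (p 2 * p 4 - p 3 * p 3) - p 1 * (p 1 * p 4 - p 3 * p 2)
         + p 2 * (p 1 * p 3 - p 2 * p 2)"
      "hankel_minor f 3 (a + 1) = p 1 * (p 3 * p 5 - p 4 * p 4) - p 2 * (p 2 * p 5 - p 4 * p 3)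
         + p 3 * (p 2 * p 4 - p 3 * p 3)"
      "hankel_minor f 3 (a + 2) = p 2 * (p 4 * p 6 - p 5 * p 5) - p 3 * (p 3 * p 6 - p 5 * p 4)
         + p 4 * (p 3 * p 5 - p 4 * p 4)"
      unfolding hankel_minor_3 hankel_minor_2 p_def by (simp_all add: eval_nat_numeral)
    have "hankel_minor f 4 a
      = p 0 * (p 2 * (p 4 * p 6 - p 5 * p 5) - p 3 * (p 3 * p 6 - p 5 * p 4) + p 4 * (p 3 * p 5 - p 4 * p 4))
      - p 1 * (p 1 * (p 4 * p 6 - p 5 * p 5) - p 3 * (p 2 * p 6 - p 5 * p 3) + p 4 * (p 2 * p 5 - p 4 * p 3))
      + p 2 * (p 1 * (p 3 * p 6 - p 5 * p 4) - p 2 * (p 2 * p 6 - p 5 * p 3) + p 4 * (p 2 * p 4 - p 3 * p 3))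
      - p 3 * (p 1 * (p 3 * p 5 - p 4 * p 4) - p 2 * (p 2 * p 5 - p 4 * p 3) + p 3 * (p 2 * p 4 - p 3 * p 3))"
      unfolding hankel_minor_def p_def numeral_eq_Suc pred_numeral_simps det_mat_Suc
      by (simp add: eval_nat_numeral det_mat_Suc) algebra
    then show ?thesis
      unfolding minors by (simp only: hankel_condensation)
  qed
  have "(LC ^^ 3) f (a + 3) = LC ((LC ^^ 2) f) (a + 3)"
    by (simp add: numeral_3_eq_3 numeral_2_eq_2)
  also have "\<dots> = (LC ^^ 2) f (a + 2) * (LC ^^ 2) f ((a + 2) + 2) - (LC ^^ 2) f ((a + 1) + 2) ^ 2"
    by (simp only: LC_def[of "(LC ^^ 2) f"]) (simp add: eval_nat_numeral)
  also have "\<dots> = f (a + 2) * f (a + 4) * (hankel_minor f 3 a * hankel_minor f 3 (a + 2))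
      - f (a + 3) ^ 2 * hankel_minor f 3 (a + 1) ^ 2"
    unfolding LC_2 by (simp add: power_mult_distrib eval_nat_numeral)
  also have "hankel_minor f 3 a * hankel_minor f 3 (a + 2)
      = hankel_minor f 4 a * hankel_minor f 2 (a + 2) + hankel_minor f 3 (a + 1) ^ 2"
    by (simp only: D diff_add_cancel)
  also have "f (a + 2) * f (a + 4) * (hankel_minor f 4 a * hankel_minor f 2 (a + 2) + hankel_minor f 3 (a + 1) ^ 2)
      - f (a + 3) ^ 2 * hankel_minor f 3 (a + 1) ^ 2
    = f (a + 2) * f (a + 4) * hankel_minor f 2 (a + 2) * hankel_minor f 4 a
    + (f (a + 2) * f (a + 4) - f (a + 3) ^ 2) * hankel_minor f 3 (a + 1) ^ 2"
    by (simp add: algebra_simps)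
  also have "f (a + 2) * f (a + 4) - f (a + 3) ^ 2 = hankel_minor f 2 (a + 2)"
    unfolding hankel_minor_2 by (simp add: eval_nat_numeral)
  finally show ?thesis .
qed

lemma x_log_convex_3:
  assumes "x_Stieltjes_moment f"
  shows "x_log_convex 3 f"
  unfolding x_log_convex_def
proof (intro allI impI)
  fix m i :: nat
  assume m: "m \<le> 3" and i: "m \<le> i"
  have nonneg: "nonneg_coeffs (hankel_minor f n a)" for n a
  proof -
    have "nonneg_coeffs (Determinant.det (Matrix.mat n n (\<lambda>(i, j). f ((a + i) + j))))"
      by (rule x_totally_positiveD[OF assms[unfolded x_Stieltjes_moment_def], of n "\<lambda>i. a + i" "\<lambda>j. j"])
        (auto intro: strict_mono_onI)
    then show ?thesis by (simp add: hankel_minor_def)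
  qed
  have f: "nonneg_coeffs (f a)" for a
    using nonneg[of 1 a] by (simp add: hankel_minor_1)
  \<comment> \<open>Writing \<open>i\<close> as \<open>a + m\<close> keeps the index subtractions in
    \<open>LC\<close> from being truncated.\<close>
  obtain a where a: "i = a + m" using i by (metis add.commute le_Suc_ex)
  consider "m = 0" | "m = 1" | "m = 2" | "m = 3" using m by linarith
  then show "nonneg_coeffs ((LC ^^ m) f i)"
  proof cases
    case 1
    then show ?thesis by (simp add: f)
  next
    case 2
    then show ?thesis using nonneg[of 2 a] by (simp add: a LC_def hankel_minor_2)
  next
    case 3
    then show ?thesis unfolding a 3 LC_2 by (intro nonneg_coeffs_mult f nonneg)
  next
    case 4
    then show ?thesis unfolding a 4 LC_3
      by (intro nonneg_coeffs_add nonneg_coeffs_mult nonneg_coeffs_power f nonneg)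
  qed
qed

section \<open>Moment sequences from weighted measures\<close>

section \<open>Stieltjes moment sequences\<close>

text \<open>The representing measure is the image under \<phi> of \<open>N\<close> with density
  \<open>w\<close>. All integrands are nonnegative, so finite values of the nonnegative integrals
  already give integrability.\<close>

lemma Stieltjes_momentI:
  fixes N :: "'b measure" and w \<phi> :: "'b \<Rightarrow> real"
  assumes [measurable]: "w \<in> borel_measurable N" "\<phi> \<in> borel_measurable N"
    and w: "\<And>\<omega>. \<omega> \<in> space N \<Longrightarrow> 0 \<le> w \<omega>" and \<phi>: "\<And>\<omega>. \<omega> \<in> space N \<Longrightarrow> 0 \<le> \<phi> \<omega>"
    and a: "\<And>n. 0 \<le> a n" and int: "\<And>n. (\<integral>\<^sup>+\<omega>. ennreal (w \<omega> * \<phi> \<omega> ^ n) \<partial>N) = ennreal (a n)"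
  shows "Stieltjes_moment a"
  unfolding Stieltjes_moment_def
proof (intro exI conjI allI)
  let ?R = "restrict_space borel {0::real..}"
  let ?M = "distr (density N w) ?R \<phi>"
  show "sets ?M = sets ?R" by simp
  fix n
  have \<phi>_R: "\<phi> \<in> measurable (density N w) ?R"
    by (rule measurable_restrict_space2) (use \<phi> in auto)
  have pow: "(\<lambda>x. x ^ n) \<in> borel_measurable ?R"
    by (rule measurable_restrict_space1) measurable
  show "has_bochner_integral ?M (\<lambda>x. x ^ n) (a n)"
  proof (rule has_bochner_integral_nn_integral)
    show "(\<lambda>x. x ^ n) \<in> borel_measurable ?M"
      using pow by simp
    show "AE x in ?M. 0 \<le> x ^ n"
      by (rule AE_I2) (simp add: space_restrict_space)
    show "0 \<le> a n" by (rule a)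
    have "(\<integral>\<^sup>+x. ennreal (x ^ n) \<partial>?M) = (\<integral>\<^sup>+\<omega>. ennreal (\<phi> \<omega> ^ n) \<partial>density N w)"
      using pow by (intro nn_integral_distr[OF \<phi>_R]) simp
    also have "\<dots> = (\<integral>\<^sup>+\<omega>. ennreal (w \<omega>) * ennreal (\<phi> \<omega> ^ n) \<partial>N)"
      by (rule nn_integral_density) measurable
    also have "\<dots> = (\<integral>\<^sup>+\<omega>. ennreal (w \<omega> * \<phi> \<omega> ^ n) \<partial>N)"
      by (rule nn_integral_cong) (simp add: ennreal_mult' w)
    finally show "(\<integral>\<^sup>+x. ennreal (x ^ n) \<partial>?M) = ennreal (a n)"
      by (simp only: int)
  qed
qed

text \<open>The moments are restated as nonnegative integrals; moment 0 gives finiteness, which the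
  product measures need for iterated integration.\<close>

lemma Stieltjes_momentE:
  assumes "Stieltjes_moment a"
  obtains M :: "real measure" where
    "(\<lambda>x. x) \<in> borel_measurable M" "\<And>x. x \<in> space M \<Longrightarrow> 0 \<le> x" "finite_measure M"
    "\<And>n. (\<integral>\<^sup>+x. ennreal (x ^ n) \<partial>M) = ennreal (a n)" "\<And>n. 0 \<le> a n"
proof -
  obtain M :: "real measure" where M: "sets M = sets (restrict_space borel {0..})"
    and int: "\<And>n. has_bochner_integral M (\<lambda>x. x ^ n) (a n)"
    using assms unfolding Stieltjes_moment_def by blast
  have id: "(\<lambda>x. x) \<in> borel_measurable M"
    unfolding measurable_cong_sets[OF M refl] by (rule measurable_restrict_space1) measurable
  have pos: "0 \<le> x" if "x \<in> space M" for x
    using that sets_eq_imp_space_eq[OF M] by (simp add: space_restrict_space)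
  have nonneg: "0 \<le> a n" for n
    using has_bochner_integral_integral_eq[OF int[of n]] pos
    by (metis (mono_tags, lifting) integral_nonneg_AE AE_I2 zero_le_power)
  have nn: "(\<integral>\<^sup>+x. ennreal (x ^ n) \<partial>M) = ennreal (a n)" for n
    using nn_integral_eq_integral[of M "\<lambda>x. x ^ n"] int[of n] pos
    by (auto simp: has_bochner_integral_iff)
  have "finite_measure M"
    by (rule finite_measureI) (use nn[of 0] in simp)
  then show thesis using id pos nn nonneg that by blast
qed

lemma nn_integral_sum_cmult:
  fixes f :: "nat \<Rightarrow> 'b \<Rightarrow> real"
  assumes c: "\<And>k. k \<le> n \<Longrightarrow> 0 \<le> c k" and m: "\<And>k. k \<le> n \<Longrightarrow> 0 \<le> m k"
    and [measurable]: "\<And>k. f k \<in> borel_measurable M"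
    and f: "\<And>k \<omega>. \<omega> \<in> space M \<Longrightarrow> 0 \<le> f k \<omega>"
    and int: "\<And>k. k \<le> n \<Longrightarrow> (\<integral>\<^sup>+\<omega>. ennreal (f k \<omega>) \<partial>M) = ennreal (m k)"
  shows "(\<integral>\<^sup>+\<omega>. ennreal (\<Sum>k\<le>n. c k * f k \<omega>) \<partial>M) = ennreal (\<Sum>k\<le>n. c k * m k)"
proof -
  have "(\<integral>\<^sup>+\<omega>. ennreal (\<Sum>k\<le>n. c k * f k \<omega>) \<partial>M) = (\<integral>\<^sup>+\<omega>. (\<Sum>k\<le>n. ennreal (c k) * ennreal (f k \<omega>)) \<partial>M)"
    by (intro nn_integral_cong) (subst sum_ennreal[symmetric], auto simp: c f ennreal_mult')
  also have "\<dots> = (\<Sum>k\<le>n. ennreal (c k) * (\<integral>\<^sup>+\<omega>. ennreal (f k \<omega>) \<partial>M))"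
    by (simp add: nn_integral_sum nn_integral_cmult)
  also have "\<dots> = (\<Sum>k\<le>n. ennreal (c k * m k))"
    by (intro sum.cong) (simp_all add: int ennreal_mult' c)
  also have "\<dots> = ennreal (\<Sum>k\<le>n. c k * m k)"
    by (rule sum_ennreal) (simp add: c m)
  finally show ?thesis .
qed

text \<open>With c = \<beta>2 / \<beta>1 the product is \<beta>1^n Gamma(1 + c + n) / Gamma(1 + c),
  the n-th moment of \<beta>1 times a Gamma variable of shape 1 + c. For \<beta>1 = 0 it is the n-th
  power of \<beta>2, represented by a point mass.\<close>

lemma Stieltjes_moment_rising_product:
  assumes "0 \<le> \<beta>1" "0 \<le> \<beta>2"
  shows "Stieltjes_moment (\<lambda>n. \<Prod>i=1..n. \<beta>1 * real i + \<beta>2)"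
proof (cases "\<beta>1 = 0")
  case True
  show ?thesis
    by (rule Stieltjes_momentI[where N = "count_space (UNIV :: unit set)" and w = "\<lambda>_. 1" and \<phi> = "\<lambda>_. \<beta>2"])
      (use True assms in \<open>auto simp: nn_integral_count_space_finite\<close>)
next
  case False
  define c where "c = \<beta>2 / \<beta>1"
  have c: "0 \<le> c" "\<beta>1 > 0" using assms False by (auto simp: c_def)
  have \<beta>2: "\<beta>2 = \<beta>1 * c" using False by (simp add: c_def)
  have G: "Gamma (1 + c) > 0" using c by (simp add: Gamma_real_pos)
  have prod: "(\<Prod>i=1..n. \<beta>1 * real i + \<beta>2) = \<beta>1 ^ n * Gamma (1 + c + real n) / Gamma (1 + c)" for n
  proof -
    have "1 + c \<notin> \<int>\<^sub>\<le>\<^sub>0" using c by (auto elim!: nonpos_Ints_cases)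
    then have "\<beta>1 ^ n * Gamma (1 + c + real n) / Gamma (1 + c) = \<beta>1 ^ n * pochhammer (1 + c) n"
      by (simp add: pochhammer_Gamma)
    also have "\<dots> = (\<Prod>i=0..<n. \<beta>1 * (1 + c + real i))"
      by (simp add: pochhammer_prod prod.distrib)
    also have "\<dots> = (\<Prod>i=1..n. \<beta>1 * real i + \<beta>2)"
      unfolding \<beta>2 by (rule prod.reindex_bij_witness[of _ "\<lambda>i. i - 1" Suc]) (auto simp: algebra_simps)
    finally show ?thesis by simp
  qed
  let ?w = "\<lambda>t. indicator {0..} t * (t powr c / exp t) / Gamma (1 + c)"
  show ?thesis
  \<comment> \<open>The absolute value makes the variable nonnegative on the whole line; the weight
    vanishes for negative \<open>t\<close>.\<close>
  proof (rule Stieltjes_momentI[where N = lborel and w = ?w and \<phi> = "\<lambda>t. \<beta>1 * \<bar>t\<bar>"])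
    show "?w \<in> borel_measurable lborel" by measurable
    show "(\<lambda>t. \<beta>1 * \<bar>t\<bar>) \<in> borel_measurable lborel" by measurable
    show "0 \<le> ?w t" for t using G by simp
    show "0 \<le> \<beta>1 * \<bar>t\<bar>" for t using c by simp
    show "0 \<le> (\<Prod>i=1..n. \<beta>1 * real i + \<beta>2)" for n
      using assms by (intro prod_nonneg) auto
    fix n
    let ?I = "\<lambda>t. t powr (1 + c + real n - 1) / exp t"
    let ?C = "\<beta>1 ^ n / Gamma (1 + c)"
    have "?w t * (\<beta>1 * \<bar>t\<bar>) ^ n = ?C * (indicator {0..} t * ?I t)" for t
    proof (cases "t > 0")
      case True
      then show ?thesis by (simp add: powr_add powr_realpow power_mult_distrib mult_ac)
    next
      case False
      then show ?thesis by (cases "t = 0") auto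
    qed
    then have "(\<integral>\<^sup>+t. ennreal (?w t * (\<beta>1 * \<bar>t\<bar>) ^ n) \<partial>lborel)
        = (\<integral>\<^sup>+t. ennreal ?C * ennreal (indicator {0..} t * ?I t) \<partial>lborel)"
      using c G by (intro nn_integral_cong) (simp add: ennreal_mult'[symmetric])
    also have "\<dots> = ennreal ?C * (\<integral>\<^sup>+t. ennreal (indicator {0..} t * ?I t) \<partial>lborel)"
      by (rule nn_integral_cmult) measurable
    also have "(\<integral>\<^sup>+t. ennreal (indicator {0..} t * ?I t) \<partial>lborel) = ennreal (Gamma (1 + c + real n))"
      by (rule nn_integral_has_integral_lebesgue) (use c Gamma_integral_real[of "1 + c + real n"] in auto)
    also have "ennreal ?C * \<dots> = ennreal (\<Prod>i=1..n. \<beta>1 * real i + \<beta>2)"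
      using c G unfolding prod by (simp add: ennreal_mult'[symmetric])
    finally show "(\<integral>\<^sup>+t. ennreal (?w t * (\<beta>1 * \<bar>t\<bar>) ^ n) \<partial>lborel) = ennreal (\<Prod>i=1..n. \<beta>1 * real i + \<beta>2)" .
  qed
qed

section \<open>Stirling-type coefficients as Poisson moments\<close>

section \<open>The Poisson kernel\<close>

text \<open>For \<open>a1 = 1\<close> and \<open>a2 = 0\<close> these are the Stirling numbers of
  the second kind.\<close>

abbreviation affine_stirling :: "'a::comm_ring_1 \<Rightarrow> 'a \<Rightarrow> nat \<Rightarrow> nat \<Rightarrow> 'a" where
  "affine_stirling a1 a2 \<equiv> stieltjes_mat (\<lambda>k. a2 + a1 * of_nat k) (\<lambda>_. 0)"

lemma T_coeff_lam_0:
  "T_coeff a1 a2 b1 b2 0 n k = (\<Prod>i=1..k. b1 * of_nat i + b2) * affine_stirling a1 a2 n k"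
proof -
  have "s_seq a1 a2 b1 b2 0 0 = (\<lambda>k. a2 + a1 * of_nat k)" "r_seq a1 b1 b2 0 0 = (\<lambda>_. 0)"
    by (simp_all add: s_seq_def r_seq_def fun_eq_iff)
  then show ?thesis
    using T_coeff_eq_stieltjes_mat[of a1 a2 b1 b2 0 0 n k] by simp
qed

text \<open>Here \<open>fact k * of_nat (i choose k)\<close> is a falling factorial. Multiplication
  by \<open>a2 + a1 * i\<close> sends the k-th basis element to \<open>a2 + a1 * k\<close> times
  itself plus the next one, which is the recurrence of \<open>affine_stirling\<close>.\<close>

lemma affine_stirling_falling:
  fixes a1 a2 :: real
  shows "(a2 + a1 * of_nat i) ^ n
    = (\<Sum>k\<le>n. affine_stirling a1 a2 n k * (a1 ^ k * fact k * of_nat (i choose k)))"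
proof (induction n)
  case 0
  then show ?case by simp
next
  case (Suc n)
  let ?h = "\<lambda>k. a1 ^ k * fact k * of_nat (i choose k) :: real"
  have h: "(a2 + a1 * of_nat k) * ?h k + ?h (Suc k) = (a2 + a1 * of_nat i) * ?h k" for k
  proof -
    have "of_nat i * of_nat (i choose k) = of_nat k * of_nat (i choose k)
        + of_nat (Suc k) * (of_nat (i choose Suc k) :: real)"
      using binomial_power_absorb[of i k 1] by simp
    then have "(a2 + a1 * of_nat i) * ?h k
        = a2 * ?h k + a1 ^ Suc k * fact k * (of_nat k * of_nat (i choose k) + of_nat (Suc k) * of_nat (i choose Suc k))"
      by (simp add: algebra_simps)
    then show ?thesis by (simp add: algebra_simps)
  qed
  have "(a2 + a1 * of_nat i) ^ Suc n = (\<Sum>k\<le>n. affine_stirling a1 a2 n k * ((a2 + a1 * of_nat i) * ?h k))"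
    by (simp add: Suc.IH sum_distrib_left mult_ac)
  then show ?case
    unfolding sum_stieltjes_mat_Suc h[symmetric] by (simp cong: if_cong)
qed

lemma affine_stirling_slope_0:
  "(a2 + v) ^ n = (\<Sum>k\<le>n. affine_stirling 0 a2 n k * v ^ k)"
proof (induction n)
  case 0
  then show ?case by simp
next
  case (Suc n)
  have "(a2 + v) ^ Suc n = (\<Sum>k\<le>n. affine_stirling 0 a2 n k * ((a2 + v) * v ^ k))"
    by (simp add: Suc.IH sum_distrib_left mult_ac)
  then show ?case
    unfolding sum_stieltjes_mat_Suc by (simp add: algebra_simps cong: if_cong)
qed

lemma affine_stirling_nonneg:
  fixes a1 a2 :: real
  assumes "0 \<le> a1" "0 \<le> a2"
  shows "0 \<le> affine_stirling a1 a2 n k"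
  using assms by (induction n arbitrary: k) auto

text \<open>The terms with \<open>i < k\<close> vanish, and the shift by \<open>k\<close> leaves
  \<rho>^k times the normalised exponential series.\<close>

lemma poisson_factorial_moment:
  fixes \<rho> :: real
  shows "(\<lambda>i. exp (- \<rho>) * \<rho> ^ i / fact i * (fact k * real (i choose k))) sums \<rho> ^ k"
proof -
  let ?f = "\<lambda>i. exp (- \<rho>) * \<rho> ^ i / fact i * (fact k * real (i choose k))"
  have "(\<lambda>i. ?f (i + k)) sums \<rho> ^ k \<longleftrightarrow> ?f sums \<rho> ^ k"
    by (rule sums_zero_iff_shift) (simp add: binomial_eq_0)
  moreover have "(\<lambda>i. ?f (i + k)) = (\<lambda>i. exp (- \<rho>) * \<rho> ^ k * (\<rho> ^ i /\<^sub>R fact i))"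
    by (rule ext) (simp add: binomial_fact field_simps power_add)
  moreover have "exp (- \<rho>) * \<rho> ^ k * exp \<rho> = \<rho> ^ k"
    by (simp add: exp_minus)
  moreover have "(\<lambda>i. exp (- \<rho>) * \<rho> ^ k * (\<rho> ^ i /\<^sub>R fact i)) sums (exp (- \<rho>) * \<rho> ^ k * exp \<rho>)"
    by (intro sums_mult exp_converges)
  ultimately show ?thesis by metis
qed

text \<open>
  \<open>poisson_weight a v\<close> and \<open>poisson_value a c v\<close> describe the law of \<open>c + a * P\<close> with \<open>P\<close> Poisson
  distributed with mean \<open>v / a\<close>; for \<open>a = 0\<close> it degenerates to the point mass at \<open>c + v\<close>.
\<close>

definition poisson_weight :: "real \<Rightarrow> real \<Rightarrow> nat \<Rightarrow> real" where
  "poisson_weight a v i =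
     (if a = 0 then (if i = 0 then 1 else 0) else exp (- (v / a)) * (v / a) ^ i / fact i)"

definition poisson_value :: "real \<Rightarrow> real \<Rightarrow> real \<Rightarrow> nat \<Rightarrow> real" where
  "poisson_value a c v i = (if a = 0 then c + v else c + a * real i)"

text \<open>Expand the powers in falling factorials and insert the factorial moments. The factors
  a^k cancel the denominators of (v / a)^k, so the degenerate case \<open>a = 0\<close> obeys the
  same formula.\<close>

lemma poisson_moment:
  "(\<lambda>i. poisson_weight a v i * poisson_value a c v i ^ n) sums (\<Sum>k\<le>n. affine_stirling a c n k * v ^ k)"
proof (cases "a = 0")
  case True
  have "(\<lambda>i. if i = 0 then (c + v) ^ n else 0) sums ((c + v) ^ n)"
    using sums_single[of 0 "\<lambda>_. (c + v) ^ n"] by simp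
  moreover have "(\<lambda>i. poisson_weight a v i * poisson_value a c v i ^ n) = (\<lambda>i. if i = 0 then (c + v) ^ n else 0)"
    by (auto simp: True poisson_weight_def poisson_value_def)
  ultimately show ?thesis
    unfolding affine_stirling_slope_0[of c v n] True by simp
next
  case False
  let ?\<rho> = "v / a"
  have "(\<lambda>i. \<Sum>k\<le>n. affine_stirling a c n k * a ^ k *
      (exp (- ?\<rho>) * ?\<rho> ^ i / fact i * (fact k * real (i choose k))))
    sums (\<Sum>k\<le>n. affine_stirling a c n k * a ^ k * ?\<rho> ^ k)"
    by (intro sums_sum sums_mult poisson_factorial_moment)
  moreover have "(\<Sum>k\<le>n. affine_stirling a c n k * a ^ k *
      (exp (- ?\<rho>) * ?\<rho> ^ i / fact i * (fact k * real (i choose k))))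
    = poisson_weight a v i * poisson_value a c v i ^ n" for i
  proof -
    have "poisson_weight a v i = exp (- ?\<rho>) * ?\<rho> ^ i / fact i" "poisson_value a c v i = c + a * of_nat i"
      using False by (simp_all add: poisson_weight_def poisson_value_def)
    then show ?thesis
      unfolding affine_stirling_falling by (simp only: affine_stirling_falling sum_distrib_left mult_ac)
  qed
  moreover have "(\<Sum>k\<le>n. affine_stirling a c n k * a ^ k * ?\<rho> ^ k) = (\<Sum>k\<le>n. affine_stirling a c n k * v ^ k)"
    using False by (intro sum.cong) (auto simp: power_divide)
  ultimately show ?thesis by simp
qed

lemma nn_integral_poisson:
  assumes "0 \<le> a" "0 \<le> c" "0 \<le> v"
  shows "(\<integral>\<^sup>+i. ennreal (poisson_weight a v i * poisson_value a c v i ^ n) \<partial>count_space UNIV)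
    = ennreal (\<Sum>k\<le>n. affine_stirling a c n k * v ^ k)"
proof -
  have 1: "0 \<le> poisson_weight a v i * poisson_value a c v i ^ n" for i
    using assms by (simp add: poisson_weight_def poisson_value_def)
  have "0 \<le> (\<Sum>k\<le>n. affine_stirling a c n k * v ^ k)"
    using assms by (intro sum_nonneg mult_nonneg_nonneg affine_stirling_nonneg) auto
  then have "(\<lambda>i. ennreal (poisson_weight a v i * poisson_value a c v i ^ n))
      sums ennreal (\<Sum>k\<le>n. affine_stirling a c n k * v ^ k)"
    using poisson_moment[of a v c n] 1 by (subst sums_ennreal) auto
  then show ?thesis
    unfolding nn_integral_count_space_nat by (rule sums_unique[symmetric])
qed

section \<open>Mixing the Poisson kernel over three independent variables\<close>

section \<open>The convolution\<close>

text \<open>Give \<open>a1\<close>, \<open>a2\<close>, \<open>lam\<close> degree 1 and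
  \<open>b1\<close>, \<open>b2\<close> degree 0: the three terms of the recurrence then have weights
  of degree 0, 1 and 2, matching the change of n - k.\<close>

lemma T_coeff_homogeneous:
  assumes "k \<le> n"
  shows "T_coeff (a1 * y) (a2 * y) b1 b2 (lam * y) n k = y ^ (n - k) * T_coeff a1 a2 b1 b2 lam n k"
  using assms
proof (induction n arbitrary: k)
  case 0
  then show ?case by simp
next
  case (Suc n)
  let ?T = "T_coeff (a1 * y) (a2 * y) b1 b2 (lam * y) n" and ?T' = "T_coeff a1 a2 b1 b2 lam n"
  have 1: "(if k = 0 then 0 else (b1 * of_nat k + b2) * ?T (k - 1))
      = y ^ (Suc n - k) * (if k = 0 then 0 else (b1 * of_nat k + b2) * ?T' (k - 1))"
    using Suc.IH[of "k - 1"] Suc.prems by (cases k) (auto simp: mult_ac)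
  have 2: "y * ?T k = y ^ (Suc n - k) * ?T' k"
    using Suc.IH[of k] Suc.prems by (cases "k \<le> n") (auto simp: Suc_diff_le T_coeff_eq_0 mult_ac)
  have 3: "y * (y * ?T (k + 1)) = y ^ (Suc n - k) * ?T' (k + 1)"
  proof (cases "k + 1 \<le> n")
    case True
    then have "Suc n - k = Suc (Suc (n - (k + 1)))" by simp
    then show ?thesis using Suc.IH[OF True] by (simp add: mult_ac)
  next
    case False
    then show ?thesis by (simp add: T_coeff_eq_0)
  qed
  have "T_coeff (a1 * y) (a2 * y) b1 b2 (lam * y) (Suc n) k
    = (if k = 0 then 0 else (b1 * of_nat k + b2) * ?T (k - 1))
      + ((2 * lam * b1 + a1) * of_nat k + a2 + lam * (b1 + b2)) * (y * ?T k)
      + lam * (a1 + lam * b1) * of_nat (k + 1) * (y * (y * ?T (k + 1)))"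
    by (simp add: algebra_simps)
  also have "\<dots> = y ^ (Suc n - k) * T_coeff a1 a2 b1 b2 lam (Suc n) k"
    unfolding 1 2 3 T_coeff.simps by (simp only: distrib_left mult_ac)
  finally show ?case .
qed

text \<open>The left side is the row polynomial for \<open>lam = 0\<close> at
  \<open>x + lam * y\<close>. Translation moves \<open>lam * y\<close> into the parameter, and
  homogeneity releases the power of \<open>y\<close>.\<close>

lemma sum_affine_stirling_eq_T_coeff:
  "(\<Sum>k\<le>n. affine_stirling (a1 * y) (a2 * y) n k * (x + lam * y) ^ k * (\<Prod>i=1..k. b1 * of_nat i + b2))
    = (\<Sum>k\<le>n. T_coeff a1 a2 b1 b2 lam n k * y ^ (n - k) * x ^ k)"
proof -
  have "(\<Sum>k\<le>n. affine_stirling (a1 * y) (a2 * y) n k * (x + lam * y) ^ k * (\<Prod>i=1..k. b1 * of_nat i + b2))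
      = T_poly (a1 * y) (a2 * y) b1 b2 0 (x + lam * y) n"
    unfolding T_poly_def T_coeff_lam_0 by (simp only: mult_ac)
  also have "\<dots> = T_poly (a1 * y) (a2 * y) b1 b2 (lam * y) x n"
    unfolding T_poly_eq_T_coeff_0 by (simp add: add.commute)
  also have "\<dots> = (\<Sum>k\<le>n. T_coeff a1 a2 b1 b2 lam n k * y ^ (n - k) * x ^ k)"
    unfolding T_poly_def by (intro sum.cong) (auto simp: T_coeff_homogeneous mult_ac)
  finally show ?thesis .
qed

lemma T_coeff_nonneg:
  fixes a1 a2 b1 b2 lam :: real
  assumes "0 \<le> a1" "0 \<le> a2" "0 \<le> b1" "0 \<le> b2" "0 \<le> lam"
  shows "0 \<le> T_coeff a1 a2 b1 b2 lam n k"
  using assms by (induction n arbitrary: k) auto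

lemma Stieltjes_moment_T_coeff:
  assumes nonneg: "0 \<le> a1" "0 \<le> a2" "0 \<le> b1" "0 \<le> b2" "0 \<le> lam"
    and "Stieltjes_moment x" "Stieltjes_moment y"
  shows "Stieltjes_moment (\<lambda>n. \<Sum>k\<le>n. T_coeff a1 a2 b1 b2 lam n k * x k * y (n - k))"
proof -
  obtain X where X[measurable]: "(\<lambda>x. x) \<in> borel_measurable X"
    and X_pos: "\<And>x. x \<in> space X \<Longrightarrow> 0 \<le> x" and "finite_measure X"
    and X_int: "\<And>n. (\<integral>\<^sup>+t. ennreal (t ^ n) \<partial>X) = ennreal (x n)" and x: "\<And>n. 0 \<le> x n"
    using \<open>Stieltjes_moment x\<close> by (rule Stieltjes_momentE) blast
  obtain Y where Y[measurable]: "(\<lambda>x. x) \<in> borel_measurable Y"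
    and Y_pos: "\<And>x. x \<in> space Y \<Longrightarrow> 0 \<le> x" and "finite_measure Y"
    and Y_int: "\<And>n. (\<integral>\<^sup>+t. ennreal (t ^ n) \<partial>Y) = ennreal (y n)" and y: "\<And>n. 0 \<le> y n"
    using \<open>Stieltjes_moment y\<close> by (rule Stieltjes_momentE) blast
  let ?g = "\<lambda>n. \<Prod>i=1..n. b1 * real i + b2"
  obtain G where G[measurable]: "(\<lambda>x. x) \<in> borel_measurable G"
    and G_pos: "\<And>x. x \<in> space G \<Longrightarrow> 0 \<le> x" and "finite_measure G"
    and G_int: "\<And>n. (\<integral>\<^sup>+t. ennreal (t ^ n) \<partial>G) = ennreal (?g n)" and g: "\<And>n. 0 \<le> ?g n"
    using Stieltjes_moment_rising_product[OF nonneg(3,4)] by (rule Stieltjes_momentE) blast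
  interpret X: finite_measure X by fact
  interpret Y: finite_measure Y by fact
  interpret G: finite_measure G by fact
  interpret C: sigma_finite_measure "count_space (UNIV :: nat set)"
    by (rule sigma_finite_measure_count_space)
  let ?XYG = "(X \<Otimes>\<^sub>M Y) \<Otimes>\<^sub>M G"
  let ?N = "?XYG \<Otimes>\<^sub>M count_space (UNIV :: nat set)"
  define v where "v = (\<lambda>p. (fst (fst p) + lam * snd (fst p)) * snd p :: real)"
  define w where "w = (\<lambda>q. poisson_weight (a1 * snd (fst (fst q))) (v (fst q)) (snd q))"
  define \<phi> where "\<phi> = (\<lambda>q. poisson_value (a1 * snd (fst (fst q))) (a2 * snd (fst (fst q))) (v (fst q)) (snd q))"
  have fst1: "(\<lambda>p. fst (fst p)) \<in> borel_measurable ?XYG"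
    by (rule measurable_compose[OF _ X]) measurable
  have fst2: "(\<lambda>p. snd (fst p)) \<in> borel_measurable ?XYG"
    by (rule measurable_compose[OF _ Y]) measurable
  have snd1: "(\<lambda>p. snd p) \<in> borel_measurable ?XYG"
    by (rule measurable_compose[OF _ G]) measurable
  note [measurable] = fst1 fst2 snd1
  have v_meas[measurable]: "v \<in> borel_measurable ?XYG"
    unfolding v_def by measurable
  \<comment> \<open>The last coordinate is countable, so measurability for each fixed value of it is
    enough.\<close>
  have w_meas[measurable]: "w \<in> borel_measurable ?N"
  proof -
    have "(\<lambda>p. poisson_weight (a1 * snd (fst p)) (v p) i) \<in> borel_measurable ?XYG" for i
      unfolding poisson_weight_def by measurable
    then have "(\<lambda>q. poisson_weight (a1 * snd (fst (fst q))) (v (fst q)) (snd q)) \<in> borel_measurable ?N"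
      by (intro measurable_compose_countable'[where I = UNIV and g = snd
            and f = "\<lambda>i q. poisson_weight (a1 * snd (fst (fst q))) (v (fst q)) i"]
          measurable_compose[OF measurable_fst]) auto
    then show ?thesis by (simp add: w_def)
  qed
  have \<phi>_meas[measurable]: "\<phi> \<in> borel_measurable ?N"
  proof -
    have "(\<lambda>p. poisson_value (a1 * snd (fst p)) (a2 * snd (fst p)) (v p) i) \<in> borel_measurable ?XYG" for i
      unfolding poisson_value_def by measurable
    then have "(\<lambda>q. poisson_value (a1 * snd (fst (fst q))) (a2 * snd (fst (fst q))) (v (fst q)) (snd q)) \<in> borel_measurable ?N"
      by (intro measurable_compose_countable'[where I = UNIV and g = snd
            and f = "\<lambda>i q. poisson_value (a1 * snd (fst (fst q))) (a2 * snd (fst (fst q))) (v (fst q)) i"]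
          measurable_compose[OF measurable_fst]) auto
    then show ?thesis by (simp add: \<phi>_def)
  qed
  show ?thesis
  proof (rule Stieltjes_momentI[of w ?N \<phi>, OF w_meas \<phi>_meas])
    fix q assume "q \<in> space ?N"
    then obtain t u s i where q: "q = (((t, u), s), i)" "0 \<le> t" "0 \<le> u" "0 \<le> s"
      by (auto simp: space_pair_measure X_pos Y_pos G_pos)
    then show "0 \<le> w q" "0 \<le> \<phi> q"
      using nonneg by (auto simp: w_def \<phi>_def v_def poisson_weight_def poisson_value_def)
  next
    show "0 \<le> (\<Sum>k\<le>n. T_coeff a1 a2 b1 b2 lam n k * x k * y (n - k))" for n
      using T_coeff_nonneg[OF nonneg] x y by (intro sum_nonneg mult_nonneg_nonneg) auto
  next
    fix n
    let ?F = "\<lambda>q. ennreal (w q * \<phi> q ^ n)"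
    have "(\<integral>\<^sup>+q. ?F q \<partial>?N) = (\<integral>\<^sup>+p. \<integral>\<^sup>+i. ?F (p, i) \<partial>count_space UNIV \<partial>?XYG)"
      by (rule C.nn_integral_fst[symmetric]) measurable
    also have "\<dots> = (\<integral>\<^sup>+p. \<integral>\<^sup>+s. \<integral>\<^sup>+i. ?F ((p, s), i) \<partial>count_space UNIV \<partial>G \<partial>(X \<Otimes>\<^sub>M Y))"
      by (rule G.nn_integral_fst[symmetric]) measurable
    also have "\<dots> = (\<integral>\<^sup>+t. \<integral>\<^sup>+u. \<integral>\<^sup>+s. \<integral>\<^sup>+i. ?F (((t, u), s), i) \<partial>count_space UNIV \<partial>G \<partial>Y \<partial>X)"
      by (rule Y.nn_integral_fst[symmetric]) measurable
    also have "\<dots> = (\<integral>\<^sup>+t. ennreal (\<Sum>k\<le>n. T_coeff a1 a2 b1 b2 lam n k * y (n - k) * t ^ k) \<partial>X)"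
    proof (rule nn_integral_cong)
      fix t assume t: "t \<in> space X"
      have "(\<integral>\<^sup>+u. \<integral>\<^sup>+s. \<integral>\<^sup>+i. ?F (((t, u), s), i) \<partial>count_space UNIV \<partial>G \<partial>Y)
          = (\<integral>\<^sup>+u. ennreal (\<Sum>k\<le>n. T_coeff a1 a2 b1 b2 lam n k * t ^ k * u ^ (n - k)) \<partial>Y)"
      proof (rule nn_integral_cong)
        fix u assume u: "u \<in> space Y"
        let ?V = "affine_stirling (a1 * u) (a2 * u) n"
        have "(\<integral>\<^sup>+s. \<integral>\<^sup>+i. ?F (((t, u), s), i) \<partial>count_space UNIV \<partial>G)
            = (\<integral>\<^sup>+s. ennreal (\<Sum>k\<le>n. ?V k * (t + lam * u) ^ k * s ^ k) \<partial>G)"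
        proof (rule nn_integral_cong)
          fix s assume s: "s \<in> space G"
          \<comment> \<open>The Poisson index is integrated first, giving a polynomial in
            \<open>s\<close>; a vanishing \<open>a1 * u\<close> is covered by the point mass in the
            kernel.\<close>
          have "(\<integral>\<^sup>+i. ?F (((t, u), s), i) \<partial>count_space UNIV) = ennreal (\<Sum>k\<le>n. ?V k * ((t + lam * u) * s) ^ k)"
            unfolding w_def \<phi>_def v_def fst_conv snd_conv
            by (rule nn_integral_poisson) (use nonneg X_pos[OF t] Y_pos[OF u] G_pos[OF s] in auto)
          then show "(\<integral>\<^sup>+i. ?F (((t, u), s), i) \<partial>count_space UNIV)
              = ennreal (\<Sum>k\<le>n. ?V k * (t + lam * u) ^ k * s ^ k)"
            by (simp only: power_mult_distrib mult.assoc)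
        qed
        \<comment> \<open>The Gamma moments supply the rising products, which turn the sum into the
          homogenised row polynomial in \<open>t\<close> and \<open>u\<close>; the outer integrals
          then replace powers by moments.\<close>
        also have "\<dots> = ennreal (\<Sum>k\<le>n. ?V k * (t + lam * u) ^ k * ?g k)"
          by (rule nn_integral_sum_cmult)
            (use nonneg X_pos[OF t] Y_pos[OF u] G_pos g in \<open>auto simp: G_int affine_stirling_nonneg\<close>)
        also have "\<dots> = ennreal (\<Sum>k\<le>n. T_coeff a1 a2 b1 b2 lam n k * t ^ k * u ^ (n - k))"
          unfolding sum_affine_stirling_eq_T_coeff by (simp only: mult_ac)
        finally show "(\<integral>\<^sup>+s. \<integral>\<^sup>+i. ?F (((t, u), s), i) \<partial>count_space UNIV \<partial>G)
            = ennreal (\<Sum>k\<le>n. T_coeff a1 a2 b1 b2 lam n k * t ^ k * u ^ (n - k))" .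
      qed
      also have "\<dots> = ennreal (\<Sum>k\<le>n. T_coeff a1 a2 b1 b2 lam n k * t ^ k * y (n - k))"
        by (rule nn_integral_sum_cmult)
          (use nonneg X_pos[OF t] Y_pos y in \<open>auto simp: Y_int T_coeff_nonneg\<close>)
      finally show "(\<integral>\<^sup>+u. \<integral>\<^sup>+s. \<integral>\<^sup>+i. ?F (((t, u), s), i) \<partial>count_space UNIV \<partial>G \<partial>Y)
          = ennreal (\<Sum>k\<le>n. T_coeff a1 a2 b1 b2 lam n k * y (n - k) * t ^ k)"
        by (simp only: mult_ac)
    qed
    also have "\<dots> = ennreal (\<Sum>k\<le>n. T_coeff a1 a2 b1 b2 lam n k * y (n - k) * x k)"
      by (rule nn_integral_sum_cmult)
        (use nonneg X_pos x y in \<open>auto simp: X_int T_coeff_nonneg\<close>)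
    also have "\<dots> = ennreal (\<Sum>k\<le>n. T_coeff a1 a2 b1 b2 lam n k * x k * y (n - k))"
      by (simp only: mult_ac)
    finally show "(\<integral>\<^sup>+q. ?F q \<partial>?N) = ennreal (\<Sum>k\<le>n. T_coeff a1 a2 b1 b2 lam n k * x k * y (n - k))" .
  qed
qed

section \<open>Assembly of the four claims\<close>

theorem theorem5p5:
  fixes a1 a2 b1 b2 lam q :: "'a::comm_ring_1"
  shows
    "has_J_fraction (Abs_fps (T_poly a1 a2 b1 b2 lam q))
        (s_seq a1 a2 b1 b2 lam q) (r_seq a1 b1 b2 lam q)
     \<and>
     (let f = T_poly (mvar Ind_a1) (mvar Ind_a2) (mvar Ind_b1) (mvar Ind_b2)
                (mvar Ind_lam) (mvar Ind_q)
      in x_Stieltjes_moment f \<and> x_log_convex 3 f)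
     \<and>
     (\<forall>(\<alpha>1::real) \<alpha>2 \<beta>1 \<beta>2 \<mu>.
        0 \<le> \<alpha>1 \<longrightarrow> 0 \<le> \<alpha>2 \<longrightarrow> 0 \<le> \<beta>1 \<longrightarrow> 0 \<le> \<beta>2 \<longrightarrow> 0 \<le> \<mu> \<longrightarrow>
        (\<forall>x y. Stieltjes_moment x \<longrightarrow> Stieltjes_moment y \<longrightarrow>
           Stieltjes_moment
             (\<lambda>n. \<Sum>k\<le>n. T_coeff \<alpha>1 \<alpha>2 \<beta>1 \<beta>2 \<mu> n k * x k * y (n - k))))
     \<and>
     (\<forall>n\<ge>1.
        Determinant.det (Matrix.mat n n (\<lambda>(i, j). T_poly a1 a2 b1 b2 lam q (i + j)))
          = (\<Prod>i = 1..<n. r_seq a1 b1 b2 lam q i ^ (n - i))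
        \<and>
        Determinant.det (Matrix.mat n n (\<lambda>(i, j). T_poly a1 a2 b1 b2 lam q (i + j + 1)))
          = (\<Prod>i = 1..<n. r_seq a1 b1 b2 lam q i ^ (n - i))
            * Q_seq (s_seq a1 a2 b1 b2 lam q) (r_seq a1 b1 b2 lam q) n)"
proof (intro conjI allI impI)
  show "has_J_fraction (Abs_fps (T_poly a1 a2 b1 b2 lam q)) (s_seq a1 a2 b1 b2 lam q) (r_seq a1 b1 b2 lam q)"
    using has_J_fraction_stieltjes_mat unfolding T_poly_eq_stieltjes_mat[abs_def] .
next
  have "x_Stieltjes_moment (T_poly (mvar Ind_a1) (mvar Ind_a2) (mvar Ind_b1) (mvar Ind_b2)
      (mvar Ind_lam) (mvar Ind_q))"
    by (intro x_Stieltjes_moment_T_poly nonneg_coeffs_mvar)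
  then show "let f = T_poly (mvar Ind_a1) (mvar Ind_a2) (mvar Ind_b1) (mvar Ind_b2)
      (mvar Ind_lam) (mvar Ind_q) in x_Stieltjes_moment f \<and> x_log_convex 3 f"
    by (simp add: Let_def x_log_convex_3)
next
  fix \<alpha>1 \<alpha>2 \<beta>1 \<beta>2 \<mu> :: real and x y
  assume "0 \<le> \<alpha>1" "0 \<le> \<alpha>2" "0 \<le> \<beta>1" "0 \<le> \<beta>2" "0 \<le> \<mu>" "Stieltjes_moment x" "Stieltjes_moment y"
  then show "Stieltjes_moment (\<lambda>n. \<Sum>k\<le>n. T_coeff \<alpha>1 \<alpha>2 \<beta>1 \<beta>2 \<mu> n k * x k * y (n - k))"
    by (rule Stieltjes_moment_T_coeff)
next
  fix n :: nat
  show "Determinant.det (Matrix.mat n n (\<lambda>(i, j). T_poly a1 a2 b1 b2 lam q (i + j)))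
      = (\<Prod>i = 1..<n. r_seq a1 b1 b2 lam q i ^ (n - i))"
    unfolding T_poly_eq_stieltjes_mat by (rule hankel_det_stieltjes_mat)
  show "Determinant.det (Matrix.mat n n (\<lambda>(i, j). T_poly a1 a2 b1 b2 lam q (i + j + 1)))
      = (\<Prod>i = 1..<n. r_seq a1 b1 b2 lam q i ^ (n - i))
        * Q_seq (s_seq a1 a2 b1 b2 lam q) (r_seq a1 b1 b2 lam q) n"
    unfolding T_poly_eq_stieltjes_mat by (rule hankel_det_Suc_stieltjes_mat)
qed

end
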